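(* Let $\sigma_0:\mathbb R_+\to[0,\infty)$, not a.e. zero, satisfy $\sigma_0\in L^\infty_{\rm loc}(\mathbb R_+)$ and $$\sigma_0(\lambda)=O(\lambda^{-l_+})\ \text{ as }\lambda\to0,\qquad \sigma_0(\lambda)=O(\lambda^{l_-})\ \text{ as }\lambda\to\infty,$$ where $l_+<1$ and $l_-$ may be arbitrarily large, and let $H_0$ be the Hankel operator with sigma-function $\sigma_0$. Let $V$ be the Hankel operator with kernel $v(t)=v_0(t+\rho)^k e^{-\beta t}$, where $v_0\in\mathbb R$, $\beta\ge0$, $\rho\ge 0$ and $k<0$, and let $H=H_0+V$. Then: $1^0$ If $k>-1$ and $\beta>0$, then $H>0$ for $v_0\ge0$, and $H$ has infinite negative spectrum for all $v_0<0$. $2^0$ Let $k\le -1$, and if $k<-1$ suppose that $\rho>0$. Put $$\nu=\Gamma(-k)\,e^{-\beta\rho}\operatorname*{ess\,inf}_{\lambda\ge\beta}\Big((\lambda-\beta)^{k+1}e^{\rho\lambda}\sigma_0(\lambda)\Big).$$ Then $H\ge0$ for $v_0\ge-\nu$, and $H$ has infinite negative spectrum for $v_0<-\nu$.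
   Context: $\mathbb R_+=(0,\infty)$ and $(\mathsf L f)(\lambda)=\int_0^\infty e^{-t\lambda}f(t)\,dt$. The Hankel operator $H_0$ with sigma-function $\sigma_0$ (kernel $h_0(t)=\int_0^\infty e^{-t\lambda}\sigma_0(\lambda)\,d\lambda$) is the nonnegative self-adjoint operator in $L^2(\mathbb R_+)$ corresponding to the closed form $h_0[f,f]=\int_0^\infty|(\mathsf L f)(\lambda)|^2\sigma_0(\lambda)\,d\lambda$ with domain $\mathcal D[h_0]$ the set of all $f\in L^2(\mathbb R_+)$ for which this integral is finite. In all cases considered, the operator $(Vf)(t)=\int_0^\infty v(t+s)f(s)\,ds$ is bounded and self-adjoint in $L^2(\mathbb R_+)$. $H=H_0+V$ is the self-adjoint operator corresponding to the closed form $h_0[f,f]+(Vf,f)$ on $\mathcal D[h_0]$. "$H$ has infinite negative spectrum" means that the spectral subspace of $H$ corresponding to $(-\infty,0)$ is infinite-dimensional. $H>0$ means $H\ge0$ and $0$ is not an eigenvalue of $H$. *)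

theory Defs
  imports
    "HOL-Probability.Probability"
    "HOL-Library.Landau_Symbols"
    "HOL-Library.Nonpos_Ints"
begin

text \<open>
  Vectors of the Hilbert space \<open>L\<^sup>2(\<real>\<^sub>+)\<close> are represented by complex functions on the half-line,
  and equality of vectors by equality almost everywhere. Unbounded operators are represented
  by their graphs, which are unions of equivalence classes in both components.
\<close>

abbreviation halfline :: "real measure"
  where "halfline \<equiv> lebesgue_on {0<..}"

definition L2 :: "(real \<Rightarrow> complex) set"
  where "L2 = {f \<in> borel_measurable halfline. integrable halfline (\<lambda>t. (cmod (f t))\<^sup>2)}"

definition ae_eq :: "(real \<Rightarrow> complex) \<Rightarrow> (real \<Rightarrow> complex) \<Rightarrow> bool"
  where "ae_eq f g \<longleftrightarrow> (AE t in halfline. f t = g t)"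

definition ip :: "(real \<Rightarrow> complex) \<Rightarrow> (real \<Rightarrow> complex) \<Rightarrow> complex"
  where "ip f g = (LINT t|halfline. f t * cnj (g t))"


section \<open>Self-adjoint operators\<close>

text \<open>
  The operator of the first representation theorem, for a form \<open>a\<close> (linear in its first argument)
  with domain \<open>D\<close>: \<open>f\<close> is in the domain of the operator and is sent to \<open>g\<close> iff \<open>f \<in> D\<close> and
  \<open>a[f,u] = (g,u)\<close> for all \<open>u \<in> D\<close>.
\<close>

definition form_operator ::
  "((real \<Rightarrow> complex) \<Rightarrow> (real \<Rightarrow> complex) \<Rightarrow> complex) \<Rightarrow> (real \<Rightarrow> complex) set
    \<Rightarrow> ((real \<Rightarrow> complex) \<times> (real \<Rightarrow> complex)) set"
  where "form_operator a D = {(f, g). f \<in> D \<and> g \<in> L2 \<and> (\<forall>u\<in>D. a f u = ip g u)}"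

definition nonneg_operator :: "((real \<Rightarrow> complex) \<times> (real \<Rightarrow> complex)) set \<Rightarrow> bool"
  where "nonneg_operator A \<longleftrightarrow> (\<forall>(f, g)\<in>A. ip g f \<in> \<real>\<^sub>\<ge>\<^sub>0)"

definition positive_operator :: "((real \<Rightarrow> complex) \<times> (real \<Rightarrow> complex)) set \<Rightarrow> bool"
  where "positive_operator A \<longleftrightarrow>
    nonneg_operator A \<and>
    (\<forall>(f, g)\<in>A. ae_eq g (\<lambda>_. 0) \<longrightarrow> ae_eq f (\<lambda>_. 0))"

definition orthogonal_projection :: "((real \<Rightarrow> complex) \<Rightarrow> (real \<Rightarrow> complex)) \<Rightarrow> bool"
  where "orthogonal_projection P \<longleftrightarrow>
    (\<forall>f\<in>L2. P f \<in> L2) \<and>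
    (\<forall>f\<in>L2. \<forall>g\<in>L2. \<forall>c d. ae_eq (P (\<lambda>t. c * f t + d * g t)) (\<lambda>t. c * P f t + d * P g t)) \<and>
    (\<forall>f\<in>L2. ae_eq (P (P f)) (P f)) \<and>
    (\<forall>f\<in>L2. \<forall>g\<in>L2. ip (P f) g = ip f (P g))"

definition projection_valued_measure ::
  "(real set \<Rightarrow> (real \<Rightarrow> complex) \<Rightarrow> (real \<Rightarrow> complex)) \<Rightarrow> bool"
  where "projection_valued_measure E \<longleftrightarrow>
    (\<forall>B\<in>sets borel. orthogonal_projection (E B)) \<and>
    (\<forall>f\<in>L2. ae_eq (E UNIV f) f) \<and>
    (\<forall>B::nat \<Rightarrow> real set. range B \<subseteq> sets borel \<and> disjoint_family B \<longrightarrow>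
      (\<forall>f\<in>L2. \<forall>g\<in>L2. (\<lambda>n. ip (E (B n) f) g) sums ip (E (\<Union>n. B n) f) g))"

text \<open>The finite measure \<open>B \<mapsto> (E(B)f,f)\<close>.\<close>

definition spectral_distribution ::
  "(real set \<Rightarrow> (real \<Rightarrow> complex) \<Rightarrow> (real \<Rightarrow> complex)) \<Rightarrow> (real \<Rightarrow> complex) \<Rightarrow> real measure"
  where "spectral_distribution E f =
    measure_of UNIV (sets borel) (\<lambda>B. ennreal (Re (ip (E B f) f)))"

text \<open>
  \<open>E\<close> is the spectral measure of the self-adjoint operator \<open>A\<close>, that is \<open>A = \<integral>x dE(x)\<close>: the domain
  of \<open>A\<close> consists of those \<open>f\<close> for which \<open>\<integral>x\<^sup>2 d(E(x)f,f)\<close> is finite, and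
  \<open>(Af,f) = \<integral>x d(E(x)f,f)\<close> on it. By polarization the diagonal values determine \<open>(Af,g)\<close>. By the
  spectral theorem each self-adjoint \<open>A\<close> has a spectral measure, and exactly one up to
  equality almost everywhere.
\<close>

definition spectral_measure_of ::
  "((real \<Rightarrow> complex) \<times> (real \<Rightarrow> complex)) set
    \<Rightarrow> (real set \<Rightarrow> (real \<Rightarrow> complex) \<Rightarrow> (real \<Rightarrow> complex)) \<Rightarrow> bool"
  where "spectral_measure_of A E \<longleftrightarrow>
    projection_valued_measure E \<and>
    Domain A = {f \<in> L2. integrable (spectral_distribution E f) (\<lambda>x. x\<^sup>2)} \<and>
    (\<forall>(f, g)\<in>A. ip g f = of_real (LINT x|spectral_distribution E f. x))"

definition finite_dimensional :: "(real \<Rightarrow> complex) set \<Rightarrow> bool"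
  where "finite_dimensional S \<longleftrightarrow>
    (\<exists>B. finite B \<and> B \<subseteq> S \<and> (\<forall>f\<in>S. \<exists>c. ae_eq f (\<lambda>t. \<Sum>b\<in>B. c b * b t)))"

text \<open>
  The quantifier ranges over the versions of the spectral measure of \<open>A\<close>, which all
  agree up to equality almost everywhere.
\<close>

definition infinite_negative_spectrum :: "((real \<Rightarrow> complex) \<times> (real \<Rightarrow> complex)) set \<Rightarrow> bool"
  where "infinite_negative_spectrum A \<longleftrightarrow>
    (\<forall>E. spectral_measure_of A E \<longrightarrow> \<not> finite_dimensional (E {..<0} ` L2))"


section \<open>Hankel operators\<close>

definition laplace :: "(real \<Rightarrow> complex) \<Rightarrow> real \<Rightarrow> complex"
  where "laplace f x = (LINT t|halfline. exp (- t * x) *\<^sub>R f t)"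

definition h0_dom :: "(real \<Rightarrow> real) \<Rightarrow> (real \<Rightarrow> complex) set"
  where "h0_dom \<sigma>\<^sub>0 =
    {f \<in> L2. integrable halfline (\<lambda>x. (cmod (laplace f x))\<^sup>2 * \<sigma>\<^sub>0 x)}"

definition h0 :: "(real \<Rightarrow> real) \<Rightarrow> (real \<Rightarrow> complex) \<Rightarrow> (real \<Rightarrow> complex) \<Rightarrow> complex"
  where "h0 \<sigma>\<^sub>0 f g =
    (LINT x|halfline. laplace f x * cnj (laplace g x) * of_real (\<sigma>\<^sub>0 x))"

definition hankel :: "(real \<Rightarrow> real) \<Rightarrow> (real \<Rightarrow> complex) \<Rightarrow> (real \<Rightarrow> complex)"
  where "hankel v f = (\<lambda>t. LINT s|halfline. v (t + s) *\<^sub>R f s)"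

definition perturbed_hankel ::
  "(real \<Rightarrow> real) \<Rightarrow> (real \<Rightarrow> real) \<Rightarrow> ((real \<Rightarrow> complex) \<times> (real \<Rightarrow> complex)) set"
  where "perturbed_hankel \<sigma>\<^sub>0 v =
    form_operator (\<lambda>f g. h0 \<sigma>\<^sub>0 f g + ip (hankel v f) g) (h0_dom \<sigma>\<^sub>0)"


section \<open>Sigma-functions\<close>

definition Linf_loc :: "(real \<Rightarrow> real) set"
  where "Linf_loc = {\<sigma> \<in> borel_measurable halfline.
    \<forall>K. compact K \<and> K \<subseteq> {0<..} \<longrightarrow> (\<exists>C. AE x in lebesgue_on K. \<bar>\<sigma> x\<bar> \<le> C)}"

definition essinf :: "'a measure \<Rightarrow> ('a \<Rightarrow> ereal) \<Rightarrow> ereal"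
  where "essinf M f = - esssup M (\<lambda>x. - f x)"

text \<open>
  The essential infimum is over \<open>\<lambda> \<ge> \<beta>\<close> in \<open>\<real>\<^sub>+\<close>, since \<open>\<sigma>\<^sub>0\<close> lives on \<open>\<real>\<^sub>+ = (0,\<infinity>)\<close>.
\<close>

definition nu :: "(real \<Rightarrow> real) \<Rightarrow> real \<Rightarrow> real \<Rightarrow> real \<Rightarrow> ereal"
  where "nu \<sigma>\<^sub>0 k \<beta> \<rho> =
    ereal (Gamma (- k) * exp (- \<beta> * \<rho>)) *
    essinf (lebesgue_on ({\<beta>..} \<inter> {0<..}))
      (\<lambda>x. ereal ((x - \<beta>) powr (k + 1) * exp (\<rho> * x) * \<sigma>\<^sub>0 x))"

end

theory Submission
  imports Defs "HOL-Complex_Analysis.Complex_Analysis" "HOL-Real_Asymp.Real_Asymp"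
begin

text \<open>
  The kernel \<open>(t + \<rho>)^k exp(-\<beta> t)\<close> is itself a Laplace transform: its sigma-function is
  \<open>w(x) = (x - \<beta>)^(-k-1) exp(-\<rho> (x - \<beta>)) / \<Gamma>(-k)\<close> for \<open>x > \<beta>\<close> and zero elsewhere. By Fubini the form
  of \<open>H\<close> is therefore \<open>\<integral> |Lf|\<^sup>2 (\<sigma>\<^sub>0 + v\<^sub>0 w)\<close> (\<open>form_identity\<close>), and everything depends on the sign of
  the total sigma-function \<open>\<sigma>\<^sub>0 + v\<^sub>0 w\<close>. The condition \<open>v\<^sub>0 \<ge> -\<nu>\<close> says exactly that this function is
  nonnegative almost everywhere (\<open>nu_le_iff\<close>); for \<open>-1 < k < 0\<close> and \<open>v\<^sub>0 < 0\<close> it is negative to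
  the right of \<open>\<beta>\<close>, where \<open>w\<close> is unbounded while \<open>\<sigma>\<^sub>0\<close> is bounded (\<open>power_sigma_dominates_near_beta\<close>).

  If the total sigma-function is nonnegative, so is \<open>H\<close>. If moreover \<open>v\<^sub>0 \<ge> 0\<close>, then \<open>Hf = 0\<close> forces
  \<open>Lf\<close> to vanish where \<open>\<sigma>\<^sub>0 > 0\<close>, which is a set of positive measure; as \<open>Lf\<close> is analytic it vanishes
  identically, and \<open>f = 0\<close> by injectivity of the Laplace transform.

  If the total sigma-function is negative on a set \<open>S\<close> of positive measure, cut \<open>S\<close> into \<open>N\<close> disjoint
  pieces \<open>E\<^sub>j\<close> of positive measure. The functions \<open>b(x) p(1/(1 + x))\<close>, with \<open>p\<close> a polynomial and
  \<open>b(x) = x / (1 + x)^(K+2)\<close>, are Laplace transforms of explicit square integrable functions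
  (\<open>test_function_exists\<close>), and by Lusin's and Weierstrass' theorems one can choose polynomials for
  which \<open>p(1/(1 + x))\<close> tends boundedly to the indicator of \<open>E\<^sub>j\<close>. The Gram matrix of the form on
  these \<open>N\<close> functions then tends to a negative diagonal matrix, so that the form becomes negative
  definite on an \<open>N\<close>-dimensional space (\<open>infinite_negative_perturbed_hankel\<close>).

  The factor \<open>b\<close> is chosen so that \<open>\<sigma>\<^sub>0 Lf\<close> is square integrable for all test functions \<open>f\<close>: the
  zero of \<open>b\<close> at \<open>0\<close> absorbs the singularity \<open>x^(-l\<^sub>p)\<close>, \<open>l\<^sub>p < 1\<close>, and the power \<open>K\<close> absorbs the growth
  at infinity. The Laplace transform being bounded in the space of square integrable functions,
  test functions then lie in the domain of the operator and not only in that of the form, where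
  the spectral representation is available: if the range of \<open>E((-\<infinity>,0))\<close> had
  dimension less than \<open>N\<close>, some nonzero combination \<open>f\<close> of test functions would satisfy
  \<open>E((-\<infinity>,0)) f = 0\<close>, and then \<open>(Hf,f) = \<integral> x d(E(x)f,f) \<ge> 0\<close>, contrary to \<open>(Hf,f) < 0\<close>
  (\<open>infinite_negative_spectrumI\<close>).
\<close>

section \<open>Lebesgue measure on the half-line\<close>

lemma sigma_finite_halfline: "sigma_finite_measure halfline"
proof -
  have fin: "emeasure lborel (cball 0 (real n) :: real set) \<noteq> \<top>" for n
    using emeasure_lborel_cball_finite[of "0::real" "real n"] by simp
  have "\<exists>A::real set set. countable A \<and> A \<subseteq> sets lebesgue \<and> \<Union> A = space lebesgue \<and>
      (\<forall>a\<in>A. emeasure lebesgue a \<noteq> \<infinity>)"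
    by (rule exI[of _ "range (\<lambda>n::nat. cball 0 (real n))"])
       (use fin in \<open>auto simp: real_arch_simple\<close>)
  then have "sigma_finite_measure (lebesgue :: real measure)"
    by unfold_locales
  then show ?thesis
    by (rule sigma_finite_measure_restrict_space) simp
qed

interpretation halfline: sigma_finite_measure halfline
  by (rule sigma_finite_halfline)

interpretation halfline_pair: pair_sigma_finite halfline halfline ..

lemma space_halfline [simp]: "space halfline = {0<..}"
  by (simp add: space_restrict_space)

lemma id_halfline [measurable]: "(\<lambda>x. x) \<in> borel_measurable halfline"
  by (intro measurable_restrict_space1 measurable_completion) simp

lemma AE_halfline_pos: "AE x in halfline. x > 0"
  by (rule AE_I2) simp

lemma AE_halfline_lebesgue: "(AE x in lebesgue. P x) \<Longrightarrow> AE x in halfline. P x"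
  by (subst AE_restrict_space_iff) (auto elim: eventually_mono)

lemma AE_lebesgue_on_iff:
  "S \<in> sets lebesgue \<Longrightarrow> (AE x in lebesgue_on S. P x) \<longleftrightarrow> (AE x in lebesgue. x \<in> S \<longrightarrow> P x)"
  by (subst AE_restrict_space_iff) auto

lemma sets_halfline_lebesgue: "S \<in> sets halfline \<Longrightarrow> S \<in> sets lebesgue"
  by (auto simp: sets_restrict_space)

lemma null_sets_of_AE_halfline:
  assumes S: "S \<in> sets lebesgue" "S \<subseteq> {0<..}" and ae: "AE x in halfline. x \<notin> S"
  shows "S \<in> null_sets lebesgue"
proof -
  have "AE x in lebesgue. x \<in> {0<..} \<longrightarrow> x \<notin> S"
    using ae by (subst (asm) AE_restrict_space_iff) auto
  then have "AE x in lebesgue. x \<notin> S"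
    using S(2) by (auto elim!: eventually_mono)
  then show ?thesis
    using S(1) AE_iff_null_sets by blast
qed

lemma not_null_of_not_AE_halfline:
  assumes "\<not> (AE x in halfline. P x)"
  shows "{x \<in> space halfline. \<not> P x} \<notin> null_sets lebesgue"
proof
  assume "{x \<in> space halfline. \<not> P x} \<in> null_sets lebesgue"
  then have "AE x in halfline. x \<notin> {x \<in> space halfline. \<not> P x}"
    by (intro AE_halfline_lebesgue AE_not_in)
  then have "AE x in halfline. P x"
    using AE_halfline_pos by eventually_elim simp
  with assms show False by simp
qed

lemma cnj_measurable [measurable]: "cnj \<in> borel_measurable borel"
  by (intro borel_measurable_continuous_onI continuous_intros)

lemma nn_integral_halfline:
  assumes "f \<in> borel_measurable borel"
  shows "(\<integral>\<^sup>+x. f x \<partial>halfline) = (\<integral>\<^sup>+x. f x * indicator {0<..} x \<partial>lborel)"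
  by (subst nn_integral_restrict_space) (auto simp: nn_integral_completion)

lemma nn_integral_powr_exp:
  fixes a x :: real
  assumes a: "a > 0" and x: "x > 0"
  shows "(\<integral>\<^sup>+t. ennreal (t powr (a - 1) * exp (- t * x)) \<partial>halfline) = ennreal (Gamma a * x powr (- a))"
proof -
  have "ennreal (Gamma a) = (\<integral>\<^sup>+t. ennreal (indicat_real {0..} t * t powr (a - 1) / exp t) \<partial>lborel)"
    by (rule Gamma_conv_nn_integral_real) fact
  also have "\<dots> = ennreal \<bar>x\<bar> * (\<integral>\<^sup>+t. ennreal (indicat_real {0..} (0 + x * t) * (0 + x * t) powr (a - 1) / exp (0 + x * t)) \<partial>lborel)"
    using x by (subst nn_integral_real_affine[where c = x and t = 0]) auto
  also have "\<dots> = ennreal x * (\<integral>\<^sup>+t. ennreal (x powr (a - 1)) * (ennreal (t powr (a - 1) * exp (- t * x)) * indicator {0<..} t) \<partial>lborel)"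
  proof -
    have "indicat_real {0..} (0 + x * t) * (0 + x * t) powr (a - 1) / exp (0 + x * t)
        = x powr (a - 1) * (t powr (a - 1) * exp (- t * x)) * indicator {0<..} t" for t
      using x by (cases "t > 0"; cases "t = 0")
        (simp_all add: powr_mult exp_minus divide_inverse mult.commute zero_le_mult_iff)
    then have "ennreal (indicat_real {0..} (0 + x * t) * (0 + x * t) powr (a - 1) / exp (0 + x * t))
        = ennreal (x powr (a - 1)) * (ennreal (t powr (a - 1) * exp (- t * x)) * indicator {0<..} t)" for t
      by (cases "t > 0") (simp_all only: ennreal_mult' powr_ge_zero indicator_simps greaterThan_iff
         mult_zero_right ennreal_0 mult_1_right not_False_eq_True)
    then show ?thesis
      using x by simp
  qed
  also have "\<dots> = ennreal x * ennreal (x powr (a - 1)) * (\<integral>\<^sup>+t. ennreal (t powr (a - 1) * exp (- t * x)) \<partial>halfline)"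
    by (subst nn_integral_halfline) (auto simp: nn_integral_cmult mult.assoc)
  also have "ennreal x * ennreal (x powr (a - 1)) = ennreal (x powr a)"
    using x by (simp add: ennreal_mult'[symmetric] powr_diff)
  finally have "ennreal (x powr (- a)) * ennreal (Gamma a) =
      ennreal (x powr (- a)) * ennreal (x powr a) * (\<integral>\<^sup>+t. ennreal (t powr (a - 1) * exp (- t * x)) \<partial>halfline)"
    by (simp add: mult.assoc)
  also have "ennreal (x powr (- a)) * ennreal (x powr a) = 1"
    using x by (simp add: ennreal_mult'[symmetric] powr_minus)
  finally show ?thesis
    using a by (simp add: ennreal_mult'[symmetric] mult.commute)
qed

section \<open>The Laplace transform of nonnegative functions\<close>

text \<open>
  Absolute convergence of all iterated integrals is settled for functions with values in
  \<open>[0,\<infinity>]\<close>, where Tonelli's theorem applies without conditions.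
\<close>
definition nn_laplace :: "(real \<Rightarrow> ennreal) \<Rightarrow> real \<Rightarrow> ennreal"
  where "nn_laplace u x = (\<integral>\<^sup>+t. ennreal (exp (- t * x)) * u t \<partial>halfline)"

lemma nn_laplace_measurable [measurable]:
  assumes [measurable]: "u \<in> borel_measurable halfline"
  shows "nn_laplace u \<in> borel_measurable halfline"
  unfolding nn_laplace_def by measurable

lemma nn_laplace_symmetric:
  assumes [measurable]: "u \<in> borel_measurable halfline" "w \<in> borel_measurable halfline"
  shows "(\<integral>\<^sup>+t. nn_laplace w t * u t \<partial>halfline) = (\<integral>\<^sup>+x. w x * nn_laplace u x \<partial>halfline)"
proof -
  have "(\<integral>\<^sup>+t. nn_laplace w t * u t \<partial>halfline) =
      (\<integral>\<^sup>+t. (\<integral>\<^sup>+x. ennreal (exp (- x * t)) * w x * u t \<partial>halfline) \<partial>halfline)"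
    unfolding nn_laplace_def by (intro nn_integral_cong nn_integral_multc[symmetric]) measurable
  also have "\<dots> = (\<integral>\<^sup>+x. (\<integral>\<^sup>+t. ennreal (exp (- x * t)) * w x * u t \<partial>halfline) \<partial>halfline)"
    by (rule halfline_pair.Fubini[of "\<lambda>(x, t). ennreal (exp (- x * t)) * w x * u t", unfolded case_prod_conv])
      measurable
  also have "\<dots> = (\<integral>\<^sup>+x. w x * nn_laplace u x \<partial>halfline)"
  proof (intro nn_integral_cong)
    fix x :: real
    have "w x * nn_laplace u x = (\<integral>\<^sup>+t. w x * (ennreal (exp (- t * x)) * u t) \<partial>halfline)"
      unfolding nn_laplace_def by (rule nn_integral_cmult[symmetric]) measurable
    moreover have "- x * t = - t * x" for t
      by simp
    ultimately show "(\<integral>\<^sup>+t. ennreal (exp (- x * t)) * w x * u t \<partial>halfline) = w x * nn_laplace u x"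
      by (simp only: mult_ac)
  qed
  finally show ?thesis .
qed

text \<open>
  Schur's test: split \<open>exp(-t x) u(t)\<close> as \<open>exp(-t x/2) t^(-1/4)\<close> times \<open>exp(-t x/2) t^(1/4) u(t)\<close> and
  apply Cauchy-Schwarz. The weights \<open>t^(-1/2)\<close> and \<open>x^(-1/2)\<close> are mapped to multiples of each other by the Laplace transform,
  each with the factor \<open>\<Gamma>(1/2) = \<surd>\<pi>\<close>.
\<close>
lemma nn_laplace_L2_bound:
  assumes [measurable]: "u \<in> borel_measurable halfline"
  shows "(\<integral>\<^sup>+x. (nn_laplace u x)\<^sup>2 \<partial>halfline) \<le> ennreal pi * (\<integral>\<^sup>+t. (u t)\<^sup>2 \<partial>halfline)"
proof -
  have half: "(\<integral>\<^sup>+t. ennreal (t powr (- 1 / 2) * exp (- t * x)) \<partial>halfline) = ennreal (sqrt pi * x powr (- 1 / 2))"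
    if "x > 0" for x
    using nn_integral_powr_exp[of "1/2" x] that by (simp add: Gamma_one_half_real)
  have sq: "ennreal r * ennreal r = ennreal (r * r)" if "r \<ge> 0" for r
    using that by (simp add: ennreal_mult)
  let ?v = "\<lambda>t. ennreal (t powr (1 / 2)) * (u t)\<^sup>2"
  have ptw: "(nn_laplace u x)\<^sup>2 \<le> ennreal (sqrt pi * x powr (- 1 / 2)) * nn_laplace ?v x"
    if x: "x > 0" for x
  proof -
    let ?f = "\<lambda>t. ennreal (exp (- t * x / 2) * t powr (- 1 / 4))"
    let ?g = "\<lambda>t. ennreal (exp (- t * x / 2) * t powr (1 / 4)) * u t"
    have eq: "nn_laplace u x = (\<integral>\<^sup>+t. ?f t * ?g t \<partial>halfline)"
      unfolding nn_laplace_def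
    proof (intro nn_integral_cong)
      fix t :: real assume "t \<in> space halfline"
      then have t: "t > 0" by simp
      have e: "exp (- t * x / 2) * exp (- t * x / 2) = exp (- t * x)"
        by (simp flip: exp_add)
      have p: "t powr (- 1 / 4) * t powr (1 / 4) = 1"
        using t by (simp flip: powr_add)
      have "(exp (- t * x / 2) * t powr (- 1 / 4)) * (exp (- t * x / 2) * t powr (1 / 4))
          = (exp (- t * x / 2) * exp (- t * x / 2)) * (t powr (- 1 / 4) * t powr (1 / 4))"
        by (simp only: mult_ac)
      also have "\<dots> = exp (- t * x)"
        unfolding e p by simp
      finally have h: "(exp (- t * x / 2) * t powr (- 1 / 4)) * (exp (- t * x / 2) * t powr (1 / 4)) = exp (- t * x)" .
      have "ennreal (exp (- t * x)) = ennreal (exp (- t * x / 2) * t powr (- 1 / 4))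
          * ennreal (exp (- t * x / 2) * t powr (1 / 4))"
        unfolding h[symmetric] by (rule ennreal_mult) auto
      then show "ennreal (exp (- t * x)) * u t = ?f t * ?g t"
        by (simp only: mult.assoc)
    qed
    have "(nn_laplace u x)\<^sup>2 \<le> (\<integral>\<^sup>+t. (?f t)\<^sup>2 \<partial>halfline) * (\<integral>\<^sup>+t. (?g t)\<^sup>2 \<partial>halfline)"
      unfolding eq
    proof (rule Cauchy_Schwarz_nn_integral)
      show "?f \<in> borel_measurable halfline" "?g \<in> borel_measurable halfline"
        by measurable
    qed
    also have "(\<integral>\<^sup>+t. (?f t)\<^sup>2 \<partial>halfline) = (\<integral>\<^sup>+t. ennreal (t powr (- 1 / 2) * exp (- t * x)) \<partial>halfline)"
    proof (intro nn_integral_cong)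
      fix t :: real assume "t \<in> space halfline"
      then have t: "t > 0" by simp
      have e: "exp (- t * x / 2) * exp (- t * x / 2) = exp (- t * x)"
        by (simp flip: exp_add)
      have p: "t powr (- 1 / 4) * t powr (- 1 / 4) = t powr (- 1 / 2)"
        using t by (simp flip: powr_add)
      show "(?f t)\<^sup>2 = ennreal (t powr (- 1 / 2) * exp (- t * x))"
        unfolding power2_eq_square e[symmetric] p[symmetric]
        by (subst sq) (auto simp: mult_ac)
    qed
    also have "\<dots> = ennreal (sqrt pi * x powr (- 1 / 2))"
      by (rule half) fact
    also have "(\<integral>\<^sup>+t. (?g t)\<^sup>2 \<partial>halfline) = nn_laplace ?v x"
      unfolding nn_laplace_def
    proof (intro nn_integral_cong)
      fix t :: real assume "t \<in> space halfline"
      then have t: "t > 0" by simp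
      have e: "exp (- t * x / 2) * exp (- t * x / 2) = exp (- t * x)"
        by (simp flip: exp_add)
      have p: "t powr (1 / 4) * t powr (1 / 4) = t powr (1 / 2)"
        using t by (simp flip: powr_add)
      have "(?g t)\<^sup>2 = ennreal (exp (- t * x / 2) * t powr (1 / 4)) * ennreal (exp (- t * x / 2) * t powr (1 / 4)) * (u t)\<^sup>2"
        by (simp add: power2_eq_square mult_ac)
      also have "ennreal (exp (- t * x / 2) * t powr (1 / 4)) * ennreal (exp (- t * x / 2) * t powr (1 / 4))
          = ennreal (exp (- t * x)) * ennreal (t powr (1 / 2))"
        unfolding e[symmetric] p[symmetric]
        by (subst sq) (auto simp: mult_ac ennreal_mult)
      finally show "(?g t)\<^sup>2 = ennreal (exp (- t * x)) * (ennreal (t powr (1 / 2)) * (u t)\<^sup>2)"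
        by (simp add: mult.assoc)
    qed
    finally show ?thesis .
  qed
  have "(\<integral>\<^sup>+x. (nn_laplace u x)\<^sup>2 \<partial>halfline) \<le> (\<integral>\<^sup>+x. ennreal (sqrt pi * x powr (- 1 / 2)) * nn_laplace ?v x \<partial>halfline)"
    by (intro nn_integral_mono) (use ptw in simp)
  also have "\<dots> = (\<integral>\<^sup>+t. nn_laplace (\<lambda>x. ennreal (sqrt pi * x powr (- 1 / 2))) t * ?v t \<partial>halfline)"
    by (rule nn_laplace_symmetric[symmetric]) measurable
  also have "\<dots> = (\<integral>\<^sup>+t. ennreal pi * (u t)\<^sup>2 \<partial>halfline)"
  proof (intro nn_integral_cong)
    fix t :: real assume "t \<in> space halfline"
    then have t: "t > 0" by simp
    have "nn_laplace (\<lambda>x. ennreal (sqrt pi * x powr (- 1 / 2))) t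
        = (\<integral>\<^sup>+x. ennreal (sqrt pi) * ennreal (x powr (- 1 / 2) * exp (- x * t)) \<partial>halfline)"
      unfolding nn_laplace_def by (intro nn_integral_cong) (simp add: ennreal_mult[symmetric] mult_ac)
    also have "\<dots> = ennreal (sqrt pi) * ennreal (sqrt pi * t powr (- 1 / 2))"
      unfolding half[OF t, symmetric] by (rule nn_integral_cmult) measurable
    also have "\<dots> = ennreal pi * ennreal (t powr (- 1 / 2))"
      by (simp add: ennreal_mult mult.assoc[symmetric]) (simp add: ennreal_mult[symmetric])
    finally have "nn_laplace (\<lambda>x. ennreal (sqrt pi * x powr (- 1 / 2))) t * ?v t
        = ennreal pi * (ennreal (t powr (- 1 / 2)) * ennreal (t powr (1 / 2))) * (u t)\<^sup>2"
      by (simp add: mult_ac)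
    also have "ennreal (t powr (- 1 / 2)) * ennreal (t powr (1 / 2)) = 1"
      using t by (simp add: ennreal_mult[symmetric] flip: powr_add)
    finally show "nn_laplace (\<lambda>x. ennreal (sqrt pi * x powr (- 1 / 2))) t * ?v t = ennreal pi * (u t)\<^sup>2"
      by simp
  qed
  also have "\<dots> = ennreal pi * (\<integral>\<^sup>+t. (u t)\<^sup>2 \<partial>halfline)"
    by (rule nn_integral_cmult) measurable
  finally show ?thesis .
qed

section \<open>The Laplace transform on the space of square integrable functions\<close>

abbreviation emod :: "(real \<Rightarrow> complex) \<Rightarrow> real \<Rightarrow> ennreal"
  where "emod f \<equiv> \<lambda>t. ennreal (cmod (f t))"

lemma L2_measurable: "f \<in> L2 \<Longrightarrow> f \<in> borel_measurable halfline"
  by (simp add: L2_def)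

lemma L2_iff:
  "f \<in> L2 \<longleftrightarrow> f \<in> borel_measurable halfline \<and> (\<integral>\<^sup>+t. (emod f t)\<^sup>2 \<partial>halfline) < \<infinity>"
proof (cases "f \<in> borel_measurable halfline")
  case True
  note [measurable] = True
  have "(\<lambda>t. (cmod (f t))\<^sup>2) \<in> borel_measurable halfline"
    by measurable
  then show ?thesis
    using True by (simp add: L2_def integrable_iff_bounded ennreal_power)
qed (simp add: L2_def)

lemma L2_emod_finite: "f \<in> L2 \<Longrightarrow> (\<integral>\<^sup>+t. (emod f t)\<^sup>2 \<partial>halfline) < \<infinity>"
  by (simp add: L2_iff)

lemma L2_dominated:
  assumes "g \<in> borel_measurable halfline" "u \<in> borel_measurable halfline"
    and "(\<integral>\<^sup>+t. (u t)\<^sup>2 \<partial>halfline) < \<infinity>" and "AE t in halfline. emod g t \<le> ennreal C * u t"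
  shows "g \<in> L2"
proof -
  note [measurable] = assms(1,2)
  have "(\<integral>\<^sup>+t. (emod g t)\<^sup>2 \<partial>halfline) \<le> (\<integral>\<^sup>+t. (ennreal C)\<^sup>2 * (u t)\<^sup>2 \<partial>halfline)"
    using assms(4) by (intro nn_integral_mono_AE) (auto elim!: eventually_mono intro: power_mono simp flip: power_mult_distrib)
  also have "\<dots> = (ennreal C)\<^sup>2 * (\<integral>\<^sup>+t. (u t)\<^sup>2 \<partial>halfline)"
    by (rule nn_integral_cmult) measurable
  also have "\<dots> < \<infinity>"
    using assms(3) by (auto simp: ennreal_mult_less_top power_less_top_ennreal)
  finally show ?thesis
    using assms(1) by (simp add: L2_iff)
qed

lemma L2_add:
  assumes "f \<in> L2" "g \<in> L2"
  shows "(\<lambda>t. f t + g t) \<in> L2"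
proof -
  note [measurable] = assms[THEN L2_measurable]
  have "(\<integral>\<^sup>+t. (ennreal (sqrt ((cmod (f t))\<^sup>2 + (cmod (g t))\<^sup>2)))\<^sup>2 \<partial>halfline)
      = (\<integral>\<^sup>+t. (emod f t)\<^sup>2 + (emod g t)\<^sup>2 \<partial>halfline)"
    by (intro nn_integral_cong) (simp add: ennreal_power)
  also have "\<dots> = (\<integral>\<^sup>+t. (emod f t)\<^sup>2 \<partial>halfline) + (\<integral>\<^sup>+t. (emod g t)\<^sup>2 \<partial>halfline)"
    by (rule nn_integral_add) measurable
  also have "\<dots> < \<infinity>"
    using assms by (simp add: L2_iff)
  finally have fin: "(\<integral>\<^sup>+t. (ennreal (sqrt ((cmod (f t))\<^sup>2 + (cmod (g t))\<^sup>2)))\<^sup>2 \<partial>halfline) < \<infinity>" .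
  show ?thesis
  proof (rule L2_dominated[OF _ _ fin])
    show "AE t in halfline. emod (\<lambda>t. f t + g t) t \<le> ennreal (sqrt 2) * ennreal (sqrt ((cmod (f t))\<^sup>2 + (cmod (g t))\<^sup>2))"
    proof (rule AE_I2)
      fix t
      have "(cmod (f t + g t))\<^sup>2 \<le> (cmod (f t) + cmod (g t))\<^sup>2"
        by (intro power_mono norm_triangle_ineq) auto
      also have "\<dots> \<le> 2 * ((cmod (f t))\<^sup>2 + (cmod (g t))\<^sup>2)"
        using sum_squares_bound[of "cmod (f t)" "cmod (g t)"] by (simp add: power2_sum)
      finally have "cmod (f t + g t) \<le> sqrt (2 * ((cmod (f t))\<^sup>2 + (cmod (g t))\<^sup>2))"
        by (rule real_le_rsqrt)
      then show "emod (\<lambda>t. f t + g t) t \<le> ennreal (sqrt 2) * ennreal (sqrt ((cmod (f t))\<^sup>2 + (cmod (g t))\<^sup>2))"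
        unfolding real_sqrt_mult by (subst ennreal_mult[symmetric]) (auto intro: ennreal_leI)
    qed
  qed measurable
qed

lemma L2_cmult:
  assumes "f \<in> L2"
  shows "(\<lambda>t. c * f t) \<in> L2"
proof -
  note [measurable] = assms[THEN L2_measurable]
  show ?thesis
    by (rule L2_dominated[OF _ _ L2_emod_finite[OF assms], of _ "cmod c"])
       (measurable, simp add: norm_mult ennreal_mult)
qed

lemma L2_sum:
  "finite I \<Longrightarrow> (\<And>i. i \<in> I \<Longrightarrow> f i \<in> L2) \<Longrightarrow> (\<lambda>t. \<Sum>i\<in>I. c i * f i t) \<in> L2"
proof (induction I rule: finite_induct)
  case empty
  then show ?case by (simp add: L2_def)
next
  case (insert i I)
  then have "(\<lambda>t. c i * f i t + (\<Sum>i\<in>I. c i * f i t)) \<in> L2"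
    by (intro L2_add L2_cmult) auto
  with insert show ?case by simp
qed

lemma nn_pairing_finite:
  assumes "u \<in> borel_measurable M" "w \<in> borel_measurable M"
    and "(\<integral>\<^sup>+t. (u t)\<^sup>2 \<partial>M) < \<infinity>" "(\<integral>\<^sup>+t. (w t)\<^sup>2 \<partial>M) < \<infinity>"
  shows "(\<integral>\<^sup>+t. u t * w t \<partial>M) < \<infinity>"
proof -
  have "(\<integral>\<^sup>+t. u t * w t \<partial>M)\<^sup>2 < \<infinity>"
    by (rule le_less_trans[OF Cauchy_Schwarz_nn_integral[OF assms(1,2)]])
       (use assms(3,4) in \<open>simp add: ennreal_mult_less_top\<close>)
  then show ?thesis
    by (simp add: power_less_top_ennreal)
qed

lemma nn_laplace_L2_finite:
  assumes "u \<in> borel_measurable halfline" "(\<integral>\<^sup>+t. (u t)\<^sup>2 \<partial>halfline) < \<infinity>"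
  shows "(\<integral>\<^sup>+x. (nn_laplace u x)\<^sup>2 \<partial>halfline) < \<infinity>"
  by (rule le_less_trans[OF nn_laplace_L2_bound[OF assms(1)]])
     (use assms(2) in \<open>simp add: ennreal_mult_less_top\<close>)

lemma nn_laplace_finite:
  assumes "u \<in> borel_measurable halfline" "(\<integral>\<^sup>+t. (u t)\<^sup>2 \<partial>halfline) < \<infinity>" "x > 0"
  shows "nn_laplace u x < \<infinity>"
  unfolding nn_laplace_def
proof (rule nn_pairing_finite)
  have "(\<integral>\<^sup>+t. (ennreal (exp (- t * x)))\<^sup>2 \<partial>halfline) = (\<integral>\<^sup>+t. ennreal (t powr (1 - 1) * exp (- t * (2 * x))) \<partial>halfline)"
    by (intro nn_integral_cong) (auto simp: ennreal_power exp_double[symmetric] mult_ac)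
  also have "\<dots> < \<infinity>"
    by (subst nn_integral_powr_exp) (use assms in auto)
  finally show "(\<integral>\<^sup>+t. (ennreal (exp (- t * x)))\<^sup>2 \<partial>halfline) < \<infinity>" .
qed (use assms in measurable)

lemma laplace_measurable [measurable]:
  assumes [measurable]: "f \<in> borel_measurable halfline"
  shows "laplace f \<in> borel_measurable halfline"
  unfolding laplace_def by measurable

lemma emod_laplace_le: "emod (laplace f) x \<le> nn_laplace (emod f) x"
proof (cases "integrable halfline (\<lambda>t. exp (- t * x) *\<^sub>R f t)")
  case True
  then have "emod (laplace f) x \<le> (\<integral>\<^sup>+t. ennreal (norm (exp (- t * x) *\<^sub>R f t)) \<partial>halfline)"
    unfolding laplace_def by (rule integral_norm_bound_ennreal)
  also have "\<dots> = nn_laplace (emod f) x"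
    unfolding nn_laplace_def by (intro nn_integral_cong) (simp add: ennreal_mult)
  finally show ?thesis .
qed (simp add: laplace_def not_integrable_integral_eq)

lemma integrable_laplace_iff:
  assumes [measurable]: "f \<in> borel_measurable halfline"
  shows "integrable halfline (\<lambda>t. exp (- t * x) *\<^sub>R f t) \<longleftrightarrow> nn_laplace (emod f) x < \<infinity>"
proof -
  have "(\<lambda>t. exp (- t * x) *\<^sub>R f t) \<in> borel_measurable halfline"
    by measurable
  moreover have "(\<integral>\<^sup>+t. ennreal (norm (exp (- t * x) *\<^sub>R f t)) \<partial>halfline) = nn_laplace (emod f) x"
    unfolding nn_laplace_def by (intro nn_integral_cong) (simp add: ennreal_mult)
  ultimately show ?thesis
    by (simp only: integrable_iff_bounded simp_thms)
qed

lemma integrable_laplace: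
  assumes "f \<in> L2" "x > 0"
  shows "integrable halfline (\<lambda>t. exp (- t * x) *\<^sub>R f t)"
proof -
  note [measurable] = assms(1)[THEN L2_measurable]
  show ?thesis
    by (subst integrable_laplace_iff, measurable, rule nn_laplace_finite)
       (use assms L2_emod_finite in auto)
qed

lemma laplace_sum:
  assumes "finite I" "\<And>i. i \<in> I \<Longrightarrow> f i \<in> L2" "x > 0"
  shows "laplace (\<lambda>t. \<Sum>i\<in>I. c i * f i t) x = (\<Sum>i\<in>I. c i * laplace (f i) x)"
proof -
  have "laplace (\<lambda>t. \<Sum>i\<in>I. c i * f i t) x = (LINT t|halfline. (\<Sum>i\<in>I. c i * (exp (- t * x) *\<^sub>R f i t)))"
    unfolding laplace_def by (intro Bochner_Integration.integral_cong) (auto simp: scaleR_sum_right)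
  also have "\<dots> = (\<Sum>i\<in>I. (LINT t|halfline. c i * (exp (- t * x) *\<^sub>R f i t)))"
    using assms by (intro Bochner_Integration.integral_sum integrable_mult_right integrable_laplace) auto
  also have "\<dots> = (\<Sum>i\<in>I. c i * laplace (f i) x)"
    unfolding laplace_def by (simp only: integral_mult_right_zero)
  finally show ?thesis .
qed

lemma laplace_L2:
  assumes "f \<in> L2"
  shows "laplace f \<in> L2"
proof -
  note [measurable] = assms[THEN L2_measurable]
  have "(\<integral>\<^sup>+x. (nn_laplace (emod f) x)\<^sup>2 \<partial>halfline) < \<infinity>"
    by (rule nn_laplace_L2_finite) (use L2_emod_finite[OF assms] in measurable)
  then show ?thesis
    by (rule L2_dominated[rotated 2, where C = 1]) (simp_all add: emod_laplace_le)
qed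

text \<open>
  Fubini's theorem for the kernel \<open>exp(-t x)\<close>, symmetric in \<open>t\<close> and \<open>x\<close>. The hypothesis is the finiteness
  of the double integral of the absolute values.
\<close>
lemma laplace_symmetric:
  assumes [measurable]: "p \<in> borel_measurable halfline" "f \<in> borel_measurable halfline"
    and fin: "(\<integral>\<^sup>+x. emod p x * nn_laplace (emod f) x \<partial>halfline) < \<infinity>"
  shows "integrable halfline (\<lambda>x. p x * laplace f x)"
    and "(LINT t|halfline. laplace p t * f t) = (LINT x|halfline. p x * laplace f x)"
proof -
  have "(\<lambda>x. p x * laplace f x) \<in> borel_measurable halfline"
    by measurable
  moreover have "(\<integral>\<^sup>+x. ennreal (norm (p x * laplace f x)) \<partial>halfline) < \<infinity>"
  proof (rule le_less_trans[OF nn_integral_mono fin])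
    fix x
    show "ennreal (norm (p x * laplace f x)) \<le> emod p x * nn_laplace (emod f) x"
      by (simp add: norm_mult ennreal_mult emod_laplace_le mult_left_mono)
  qed
  ultimately show "integrable halfline (\<lambda>x. p x * laplace f x)"
    by (simp only: integrable_iff_bounded simp_thms)
  let ?F = "\<lambda>x t. exp (- x * t) *\<^sub>R (p x * f t)"
  have int: "integrable (halfline \<Otimes>\<^sub>M halfline) (\<lambda>(x, t). ?F x t)"
  proof (rule halfline_pair.Fubini_integrable, unfold case_prod_conv)
    show "(\<lambda>(x, t). ?F x t) \<in> borel_measurable (halfline \<Otimes>\<^sub>M halfline)"
      by measurable
    have nn: "(\<integral>\<^sup>+t. ennreal (norm (?F x t)) \<partial>halfline) = emod p x * nn_laplace (emod f) x" for x
    proof -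
      have "(\<integral>\<^sup>+t. ennreal (norm (?F x t)) \<partial>halfline) = (\<integral>\<^sup>+t. emod p x * (ennreal (exp (- t * x)) * emod f t) \<partial>halfline)"
        by (intro nn_integral_cong) (simp add: norm_mult ennreal_mult mult_ac)
      also have "\<dots> = emod p x * nn_laplace (emod f) x"
        unfolding nn_laplace_def by (rule nn_integral_cmult) measurable
      finally show ?thesis .
    qed
    have sec: "?F x \<in> borel_measurable halfline" for x
      by measurable
    have mnorm: "(\<lambda>x. LINT t|halfline. norm (?F x t)) \<in> borel_measurable halfline"
      by measurable
    have "AE x in halfline. emod p x * nn_laplace (emod f) x \<noteq> \<infinity>"
      using fin by (intro nn_integral_PInf_AE) auto
    then show ae: "AE x in halfline. integrable halfline (?F x)"
    proof eventually_elim
      case (elim x)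
      then show ?case
        using sec[of x] nn[of x] by (simp only: integrable_iff_bounded less_top simp_thms infinity_ennreal_def)
    qed
    have "(\<integral>\<^sup>+x. ennreal (norm (LINT t|halfline. norm (?F x t))) \<partial>halfline) \<le> (\<integral>\<^sup>+x. emod p x * nn_laplace (emod f) x \<partial>halfline)"
    proof (intro nn_integral_mono_AE)
      show "AE x in halfline. ennreal (norm (LINT t|halfline. norm (?F x t))) \<le> emod p x * nn_laplace (emod f) x"
        using ae
      proof eventually_elim
        case (elim x)
        then have "integrable halfline (\<lambda>t. norm (?F x t))"
          by (rule integrable_norm)
        then have "ennreal (norm (LINT t|halfline. norm (?F x t))) \<le> (\<integral>\<^sup>+t. ennreal (norm (norm (?F x t))) \<partial>halfline)"
          by (rule integral_norm_bound_ennreal)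
        then show ?case
          using nn[of x] by (simp only: real_norm_def abs_norm_cancel)
      qed
    qed
    also note fin
    finally show "integrable halfline (\<lambda>x. LINT t|halfline. norm (?F x t))"
      using mnorm by (simp only: integrable_iff_bounded simp_thms)
  qed
  have "(LINT t|halfline. laplace p t * f t) = (LINT t|halfline. LINT x|halfline. exp (- x * t) *\<^sub>R (p x * f t))"
    unfolding laplace_def
    by (simp only: integral_mult_left_zero[symmetric] mult_scaleR_left)
  also have "\<dots> = (LINT x|halfline. LINT t|halfline. exp (- x * t) *\<^sub>R (p x * f t))"
    by (rule halfline_pair.Fubini_integral[OF int])
  also have "\<dots> = (LINT x|halfline. p x * laplace f x)"
  proof -
    have "exp (- x * t) *\<^sub>R (p x * f t) = p x * (exp (- t * x) *\<^sub>R f t)" for x t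
      by (simp add: mult.commute[of x t])
    then show ?thesis
      unfolding laplace_def by (simp only: integral_mult_right_zero)
  qed
  finally show "(LINT t|halfline. laplace p t * f t) = (LINT x|halfline. p x * laplace f x)" .
qed

section \<open>Hankel operators dominated by the Carleman operator\<close>

lemma laplace_cnj: "laplace (\<lambda>t. cnj (f t)) x = cnj (laplace f x)"
proof -
  have "laplace (\<lambda>t. cnj (f t)) x = (LINT t|halfline. cnj (exp (- t * x) *\<^sub>R f t))"
    unfolding laplace_def by (simp only: complex_cnj_scaleR)
  also have "\<dots> = cnj (laplace f x)"
    unfolding laplace_def by (rule Bochner_Integration.integral_cnj)
  finally show ?thesis .
qed

lemma laplace_cong:
  assumes "\<And>t. t > 0 \<Longrightarrow> f t = g t"
  shows "laplace f x = laplace g x"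
  unfolding laplace_def by (rule Bochner_Integration.integral_cong) (use assms in auto)

text \<open>Multiplication by an exponential shifts the transform: this is what makes kernels of Hankel type.\<close>
lemma nn_laplace_shift:
  "nn_laplace u (t + s) = nn_laplace (\<lambda>x. ennreal (exp (- x * t)) * u x) s"
proof -
  have "ennreal (exp (- x * (t + s))) * u x = ennreal (exp (- x * s)) * (ennreal (exp (- x * t)) * u x)" for x
  proof -
    have "exp (- x * (t + s)) = exp (- x * s) * exp (- x * t)"
      by (simp add: algebra_simps flip: exp_add)
    then show ?thesis
      by (simp only: ennreal_mult exp_ge_zero mult.assoc)
  qed
  then show ?thesis
    by (simp only: nn_laplace_def)
qed

lemma nn_laplace_mono: "(\<And>t. t > 0 \<Longrightarrow> u t \<le> w t) \<Longrightarrow> nn_laplace u x \<le> nn_laplace w x"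
  unfolding nn_laplace_def by (intro nn_integral_mono mult_left_mono) auto

text \<open>
  A Hankel kernel \<open>v\<close> with nonnegative sigma-function \<open>w\<close>. The bound by \<open>C/t\<close> is a bound by the Carleman
  operator with kernel \<open>1/(t + s)\<close>, which is the square of the Laplace transform; it makes the
  Hankel operator bounded, whereas multiplication by \<open>w\<close> may well be unbounded.
\<close>
locale carleman_kernel =
  fixes w v :: "real \<Rightarrow> real" and C :: real
  assumes weight_measurable [measurable]: "w \<in> borel_measurable halfline"
    and weight_nonneg: "\<And>x. w x \<ge> 0"
    and kernel_nonneg: "\<And>t. t > 0 \<Longrightarrow> v t \<ge> 0"
    and kernel_eq: "\<And>t. t > 0 \<Longrightarrow> nn_laplace (\<lambda>x. ennreal (w x)) t = ennreal (v t)"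
    and kernel_le: "\<And>t. t > 0 \<Longrightarrow> v t \<le> C / t"
begin

text \<open>
  Both sides are integrals of \<open>u\<close> against a kernel: \<open>v(t + s)\<close> on the left, and \<open>1/(t + s)\<close>, the kernel
  belonging to the constant sigma-function \<open>1\<close>, on the right.
\<close>
lemma nn_laplace_weight_le:
  assumes [measurable]: "u \<in> borel_measurable halfline" and t: "t > 0"
  shows "nn_laplace (\<lambda>x. ennreal (w x) * nn_laplace u x) t \<le> ennreal C * nn_laplace (nn_laplace u) t"
proof -
  have *: "nn_laplace (\<lambda>x. m x * nn_laplace u x) t = (\<integral>\<^sup>+s. nn_laplace m (t + s) * u s \<partial>halfline)"
    if [measurable]: "m \<in> borel_measurable halfline" for m
  proof -
    have "nn_laplace (\<lambda>x. m x * nn_laplace u x) t = (\<integral>\<^sup>+x. (ennreal (exp (- x * t)) * m x) * nn_laplace u x \<partial>halfline)"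
      by (simp only: nn_laplace_def[of _ t] mult.assoc)
    also have "\<dots> = (\<integral>\<^sup>+s. nn_laplace (\<lambda>x. ennreal (exp (- x * t)) * m x) s * u s \<partial>halfline)"
      by (rule nn_laplace_symmetric[symmetric]) measurable
    finally show ?thesis
      by (simp only: nn_laplace_shift)
  qed
  have one: "nn_laplace (\<lambda>_. 1) x = ennreal (1 / x)" if "x > 0" for x
    using nn_integral_powr_exp[of 1 x] that
    by (simp add: nn_laplace_def powr_minus_divide cong: nn_integral_cong_simp)
  have "nn_laplace (\<lambda>x. ennreal (w x) * nn_laplace u x) t = (\<integral>\<^sup>+s. nn_laplace (\<lambda>x. ennreal (w x)) (t + s) * u s \<partial>halfline)"
    by (rule *) measurable
  also have "\<dots> \<le> (\<integral>\<^sup>+s. ennreal C * (nn_laplace (\<lambda>_. 1) (t + s) * u s) \<partial>halfline)"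
  proof (intro nn_integral_mono)
    fix s :: real assume "s \<in> space halfline"
    then have ts: "t + s > 0" using t by simp
    have C: "C \<ge> 0"
      using order.trans[OF kernel_nonneg[OF ts] kernel_le[OF ts]] ts by (simp add: zero_le_divide_iff)
    have "nn_laplace (\<lambda>x. ennreal (w x)) (t + s) \<le> ennreal (C * (1 / (t + s)))"
      using kernel_le[OF ts] by (simp add: kernel_eq[OF ts] ennreal_leI)
    also have "\<dots> = ennreal C * nn_laplace (\<lambda>_. 1) (t + s)"
      using C ts by (subst ennreal_mult) (auto simp: one)
    finally show "nn_laplace (\<lambda>x. ennreal (w x)) (t + s) * u s \<le> ennreal C * (nn_laplace (\<lambda>_. 1) (t + s) * u s)"
      by (simp add: mult.assoc[symmetric] mult_right_mono)
  qed
  also have "\<dots> = ennreal C * (\<integral>\<^sup>+s. nn_laplace (\<lambda>_. 1) (t + s) * u s \<partial>halfline)"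
  proof (rule nn_integral_cmult)
    have "(\<lambda>s. nn_laplace (\<lambda>x. ennreal (exp (- x * t)) * 1) s * u s) \<in> borel_measurable halfline"
      by measurable
    then show "(\<lambda>s. nn_laplace (\<lambda>_. 1) (t + s) * u s) \<in> borel_measurable halfline"
      by (simp only: nn_laplace_shift)
  qed
  also have "(\<integral>\<^sup>+s. nn_laplace (\<lambda>_. 1) (t + s) * u s \<partial>halfline) = nn_laplace (nn_laplace u) t"
    using *[of "\<lambda>_. 1"] by (simp only: mult_1 measurable_const space_borel UNIV_I)
  finally show ?thesis .
qed

lemma laplace_weight_eq:
  assumes s: "s > 0" and t: "t > 0"
  shows "laplace (\<lambda>x. of_real (exp (- x * t) * w x)) s = of_real (v (t + s))"
proof -
  have ts: "t + s > 0" using s t by simp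
  have "laplace (\<lambda>x. of_real (exp (- x * t) * w x)) s = (LINT x|halfline. of_real (exp (- x * (t + s)) * w x))"
  proof -
    have "exp (- x * s) *\<^sub>R complex_of_real (exp (- x * t) * w x) = of_real (exp (- x * (t + s)) * w x)" for x
    proof -
      have "exp (- x * (t + s)) = exp (- x * s) * exp (- x * t)"
        by (simp add: algebra_simps flip: exp_add)
      then show ?thesis
        by (simp only: scaleR_conv_of_real of_real_mult mult.assoc)
    qed
    then show ?thesis
      by (simp only: laplace_def)
  qed
  also have "\<dots> = of_real (LINT x|halfline. exp (- x * (t + s)) * w x)"
    by (rule integral_complex_of_real)
  also have "(LINT x|halfline. exp (- x * (t + s)) * w x) = enn2real (\<integral>\<^sup>+x. ennreal (exp (- x * (t + s)) * w x) \<partial>halfline)"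
    by (rule integral_eq_nn_integral) (measurable, simp add: weight_nonneg)
  also have "(\<integral>\<^sup>+x. ennreal (exp (- x * (t + s)) * w x) \<partial>halfline) = nn_laplace (\<lambda>x. ennreal (w x)) (t + s)"
    unfolding nn_laplace_def by (intro nn_integral_cong) (simp add: ennreal_mult weight_nonneg)
  finally show ?thesis
    using kernel_nonneg[OF ts] by (simp add: kernel_eq[OF ts])
qed

lemma emod_weight: "emod (\<lambda>x. of_real (w x) * f x) x = ennreal (w x) * emod f x"
  by (simp add: norm_mult ennreal_mult weight_nonneg)

context
  fixes f :: "real \<Rightarrow> complex"
  assumes f: "f \<in> L2"
begin

lemma f_measurable [measurable]: "f \<in> borel_measurable halfline"
  by (rule L2_measurable[OF f])

lemma double_laplace_L2_finite:
  "(\<integral>\<^sup>+t. (nn_laplace (nn_laplace (emod f)) t)\<^sup>2 \<partial>halfline) < \<infinity>"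
  by (intro nn_laplace_L2_finite L2_emod_finite[OF f]) measurable

lemma weighted_laplace_bound:
  assumes t: "t > 0"
  shows "nn_laplace (emod (\<lambda>x. of_real (w x) * laplace f x)) t \<le> ennreal C * nn_laplace (nn_laplace (emod f)) t"
proof -
  have "nn_laplace (emod (\<lambda>x. of_real (w x) * laplace f x)) t \<le> nn_laplace (\<lambda>x. ennreal (w x) * nn_laplace (emod f) x) t"
    unfolding emod_weight by (intro nn_laplace_mono mult_left_mono emod_laplace_le) auto
  also have "\<dots> \<le> ennreal C * nn_laplace (nn_laplace (emod f)) t"
    by (rule nn_laplace_weight_le[OF _ t]) measurable
  finally show ?thesis .
qed

text \<open>
  This is the factorization \<open>V = L w L\<close>, valid pointwise and not only almost everywhere because
  the double integral converges absolutely for each \<open>t > 0\<close>.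
\<close>
lemma hankel_eq_laplace:
  assumes t: "t > 0"
  shows "hankel v f t = laplace (\<lambda>x. of_real (w x) * laplace f x) t"
proof -
  let ?p = "\<lambda>x. complex_of_real (exp (- x * t) * w x)"
  have "hankel v f t = (LINT s|halfline. laplace ?p s * f s)"
    unfolding hankel_def
  proof (intro Bochner_Integration.integral_cong refl)
    fix s :: real assume "s \<in> space halfline"
    then show "v (t + s) *\<^sub>R f s = laplace ?p s * f s"
      by (simp only: laplace_weight_eq t scaleR_conv_of_real space_halfline greaterThan_iff)
  qed
  also have "\<dots> = (LINT x|halfline. ?p x * laplace f x)"
  proof (rule laplace_symmetric(2))
    have "(\<integral>\<^sup>+x. emod ?p x * nn_laplace (emod f) x \<partial>halfline) = nn_laplace (\<lambda>x. ennreal (w x) * nn_laplace (emod f) x) t"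
      unfolding nn_laplace_def[of _ t]
      by (intro nn_integral_cong) (simp add: norm_mult ennreal_mult weight_nonneg mult.assoc)
    also have "\<dots> \<le> ennreal C * nn_laplace (nn_laplace (emod f)) t"
      by (rule nn_laplace_weight_le[OF _ t]) measurable
    also have "\<dots> < \<infinity>"
    proof -
      have "nn_laplace (nn_laplace (emod f)) t < \<infinity>"
        by (intro nn_laplace_finite nn_laplace_L2_finite L2_emod_finite[OF f] t) measurable
      then show ?thesis by (simp add: ennreal_mult_less_top)
    qed
    finally show "(\<integral>\<^sup>+x. emod ?p x * nn_laplace (emod f) x \<partial>halfline) < \<infinity>" .
  qed measurable
  also have "\<dots> = laplace (\<lambda>x. of_real (w x) * laplace f x) t"
    unfolding laplace_def[of _ t]
    by (simp only: of_real_mult scaleR_conv_of_real mult.assoc)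
  finally show ?thesis .
qed

lemma hankel_L2: "hankel v f \<in> L2"
proof (rule L2_dominated[OF _ _ double_laplace_L2_finite])
  have "laplace (\<lambda>x. of_real (w x) * laplace f x) \<in> borel_measurable halfline"
    by measurable
  then show "hankel v f \<in> borel_measurable halfline"
    by (rule measurable_cong[THEN iffD1, rotated]) (simp add: hankel_eq_laplace)
  show "AE t in halfline. emod (hankel v f) t \<le> ennreal C * nn_laplace (nn_laplace (emod f)) t"
  proof (rule AE_I2)
    fix t :: real assume "t \<in> space halfline"
    then have t: "t > 0" by simp
    show "emod (hankel v f) t \<le> ennreal C * nn_laplace (nn_laplace (emod f)) t"
      unfolding hankel_eq_laplace[OF t]
      by (rule order.trans[OF emod_laplace_le weighted_laplace_bound[OF t]])
  qed
qed measurable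

lemma ip_hankel:
  assumes u: "u \<in> L2"
  shows "integrable halfline (\<lambda>x. of_real (w x) * laplace f x * cnj (laplace u x))" (is ?A)
    and "ip (hankel v f) u = (LINT x|halfline. of_real (w x) * laplace f x * cnj (laplace u x))" (is ?B)
proof -
  note [measurable] = L2_measurable[OF u]
  let ?p = "\<lambda>x. of_real (w x) * laplace f x" and ?u = "\<lambda>t. cnj (u t)"
  have fin: "(\<integral>\<^sup>+x. emod ?p x * nn_laplace (emod ?u) x \<partial>halfline) < \<infinity>"
  proof -
    have "(\<integral>\<^sup>+x. emod ?p x * nn_laplace (emod ?u) x \<partial>halfline) = (\<integral>\<^sup>+t. nn_laplace (emod ?p) t * emod ?u t \<partial>halfline)"
      by (rule nn_laplace_symmetric[symmetric]) measurable
    also have "\<dots> \<le> (\<integral>\<^sup>+t. ennreal C * (nn_laplace (nn_laplace (emod f)) t * emod ?u t) \<partial>halfline)"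
      by (intro nn_integral_mono) (simp add: mult.assoc[symmetric] mult_right_mono weighted_laplace_bound)
    also have "\<dots> = ennreal C * (\<integral>\<^sup>+t. nn_laplace (nn_laplace (emod f)) t * emod ?u t \<partial>halfline)"
      by (rule nn_integral_cmult) measurable
    also have "\<dots> < \<infinity>"
    proof -
      have "(\<integral>\<^sup>+t. nn_laplace (nn_laplace (emod f)) t * emod ?u t \<partial>halfline) < \<infinity>"
        by (rule nn_pairing_finite[OF _ _ double_laplace_L2_finite])
           (simp_all only: complex_mod_cnj L2_emod_finite[OF u], measurable)
      then show ?thesis by (simp add: ennreal_mult_less_top)
    qed
    finally show ?thesis .
  qed
  have "?p \<in> borel_measurable halfline" "?u \<in> borel_measurable halfline"
    by measurable
  note sym = laplace_symmetric[OF this fin]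
  show ?A
    using sym(1) unfolding laplace_cnj .
  have "ip (hankel v f) u = (LINT t|halfline. laplace ?p t * ?u t)"
    unfolding ip_def by (intro Bochner_Integration.integral_cong) (simp_all add: hankel_eq_laplace)
  also have "\<dots> = (LINT x|halfline. ?p x * laplace ?u x)"
    by (rule sym(2))
  finally show ?B
    by (simp only: laplace_cnj)
qed

end

end

lemma L2_mult_integrable:
  assumes "f \<in> L2" "g \<in> L2"
  shows "integrable halfline (\<lambda>x. f x * g x)"
proof -
  note [measurable] = assms[THEN L2_measurable]
  have "(\<lambda>x. f x * g x) \<in> borel_measurable halfline"
    by measurable
  moreover have "(\<integral>\<^sup>+x. emod f x * emod g x \<partial>halfline) < \<infinity>"
    by (intro nn_pairing_finite L2_emod_finite assms) measurable
  ultimately show ?thesis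
    by (simp only: integrable_iff_bounded norm_mult ennreal_mult norm_ge_zero simp_thms)
qed

lemma L2_cnj: "f \<in> L2 \<Longrightarrow> (\<lambda>t. cnj (f t)) \<in> L2"
  by (auto simp: L2_iff)

lemma ip_laplace:
  assumes "p \<in> L2" "u \<in> L2"
  shows "ip (laplace p) u = (LINT x|halfline. p x * cnj (laplace u x))"
proof -
  note [measurable] = assms[THEN L2_measurable]
  have "(\<integral>\<^sup>+x. emod p x * nn_laplace (emod (\<lambda>t. cnj (u t))) x \<partial>halfline) < \<infinity>"
    by (intro nn_pairing_finite nn_laplace_L2_finite L2_emod_finite L2_cnj assms) measurable
  from laplace_symmetric(2)[OF _ _ this] show ?thesis
    unfolding ip_def laplace_cnj by measurable
qed

lemma ip_add_left:
  assumes "f \<in> L2" "g \<in> L2" "u \<in> L2"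
  shows "ip (\<lambda>t. f t + g t) u = ip f u + ip g u"
  unfolding ip_def distrib_right
  by (intro Bochner_Integration.integral_add L2_mult_integrable L2_cnj assms)

context carleman_kernel
begin

lemma hankel_cmult: "hankel (\<lambda>t. c * v t) f = (\<lambda>t. of_real c * hankel v f t)"
proof
  fix t
  have "hankel (\<lambda>t. c * v t) f t = (LINT s|halfline. of_real c * (v (t + s) *\<^sub>R f s))"
    unfolding hankel_def by (simp only: scaleR_conv_of_real of_real_mult mult.assoc)
  also have "\<dots> = of_real c * hankel v f t"
    unfolding hankel_def by (rule integral_mult_right_zero)
  finally show "hankel (\<lambda>t. c * v t) f t = of_real c * hankel v f t" .
qed

lemma ip_hankel_cmult:
  assumes "f \<in> L2" "u \<in> L2"
  shows "ip (hankel (\<lambda>t. c * v t) f) u = of_real c * ip (hankel v f) u"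
  unfolding hankel_cmult ip_def mult.assoc by (rule integral_mult_right_zero)

text \<open>
  The image of \<open>f\<close> is \<open>L(\<sigma> Lf) + c Vf\<close>, because \<open>L\<close> is bounded and symmetric.
\<close>
lemma test_function_in_Domain:
  assumes \<sigma> [measurable]: "\<sigma> \<in> borel_measurable halfline" and f: "f \<in> L2"
    and p: "(\<lambda>x. of_real (\<sigma> x) * laplace f x) \<in> L2" (is "?p \<in> L2")
  shows "f \<in> Domain (perturbed_hankel \<sigma> (\<lambda>t. c * v t))"
proof -
  note [measurable] = L2_measurable[OF f]
  let ?g = "\<lambda>t. laplace ?p t + hankel (\<lambda>t. c * v t) f t"
  have Lp: "laplace ?p \<in> L2"
    by (rule laplace_L2[OF p])
  have Vf: "hankel (\<lambda>t. c * v t) f \<in> L2"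
    unfolding hankel_cmult by (rule L2_cmult[OF hankel_L2[OF f]])
  have "integrable halfline (\<lambda>x. ?p x * cnj (laplace f x))"
    by (intro L2_mult_integrable p L2_cnj laplace_L2 f)
  moreover have "?p x * cnj (laplace f x) = complex_of_real ((cmod (laplace f x))\<^sup>2 * \<sigma> x)" for x
    by (simp only: of_real_mult complex_norm_square mult_ac)
  ultimately have dom: "f \<in> h0_dom \<sigma>"
    using f by (simp only: h0_dom_def complex_of_real_integrable_eq mem_Collect_eq simp_thms)
  moreover have "?g \<in> L2"
    by (intro L2_add Lp Vf)
  moreover have "h0 \<sigma> f u + ip (hankel (\<lambda>t. c * v t) f) u = ip ?g u" if "u \<in> h0_dom \<sigma>" for u
  proof -
    have u: "u \<in> L2" using that by (simp add: h0_dom_def)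
    have "h0 \<sigma> f u = ip (laplace ?p) u"
      unfolding h0_def ip_laplace[OF p u] by (simp only: mult_ac)
    then show ?thesis
      using ip_add_left[OF Lp Vf u] by simp
  qed
  ultimately have "(f, ?g) \<in> perturbed_hankel \<sigma> (\<lambda>t. c * v t)"
    by (simp add: perturbed_hankel_def form_operator_def)
  then show ?thesis by blast
qed

text \<open>The sigma-functions of the two summands add up.\<close>
lemma form_identity:
  assumes "(f, g) \<in> perturbed_hankel \<sigma> (\<lambda>t. c * v t)"
  shows "integrable halfline (\<lambda>x. (cmod (laplace f x))\<^sup>2 * (\<sigma> x + c * w x))"
    and "ip g f = of_real (LINT x|halfline. (cmod (laplace f x))\<^sup>2 * (\<sigma> x + c * w x))"
proof -
  have f: "f \<in> L2" and int1: "integrable halfline (\<lambda>x. (cmod (laplace f x))\<^sup>2 * \<sigma> x)"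
    using assms by (auto simp: perturbed_hankel_def form_operator_def h0_dom_def)
  have w: "of_real (w x) * laplace f x * cnj (laplace f x) = complex_of_real ((cmod (laplace f x))\<^sup>2 * w x)" for x
    by (simp only: of_real_mult complex_norm_square mult_ac)
  have int2: "integrable halfline (\<lambda>x. (cmod (laplace f x))\<^sup>2 * w x)"
    using ip_hankel(1)[OF f f] unfolding w by (simp only: complex_of_real_integrable_eq)
  have sum: "(cmod (laplace f x))\<^sup>2 * (\<sigma> x + c * w x) = (cmod (laplace f x))\<^sup>2 * \<sigma> x + c * ((cmod (laplace f x))\<^sup>2 * w x)" for x
    by (simp add: algebra_simps)
  show "integrable halfline (\<lambda>x. (cmod (laplace f x))\<^sup>2 * (\<sigma> x + c * w x))"
    unfolding sum by (intro Bochner_Integration.integrable_add integrable_mult_right int1 int2)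
  have "ip g f = h0 \<sigma> f f + ip (hankel (\<lambda>t. c * v t) f) f"
    using assms by (auto simp: perturbed_hankel_def form_operator_def)
  also have "h0 \<sigma> f f = (LINT x|halfline. of_real ((cmod (laplace f x))\<^sup>2 * \<sigma> x))"
    unfolding h0_def by (simp only: of_real_mult complex_norm_square)
  also have "\<dots> = of_real (LINT x|halfline. (cmod (laplace f x))\<^sup>2 * \<sigma> x)"
    by (rule integral_complex_of_real)
  also have "ip (hankel (\<lambda>t. c * v t) f) f = of_real c * (LINT x|halfline. of_real ((cmod (laplace f x))\<^sup>2 * w x))"
    unfolding ip_hankel_cmult[OF f f] ip_hankel(2)[OF f f] w ..
  also have "\<dots> = of_real (c * (LINT x|halfline. (cmod (laplace f x))\<^sup>2 * w x))"
    unfolding integral_complex_of_real by simp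
  also have "c * (LINT x|halfline. (cmod (laplace f x))\<^sup>2 * w x) = (LINT x|halfline. c * ((cmod (laplace f x))\<^sup>2 * w x))"
    by (rule integral_mult_right_zero[symmetric])
  finally show "ip g f = of_real (LINT x|halfline. (cmod (laplace f x))\<^sup>2 * (\<sigma> x + c * w x))"
    unfolding sum
    by (subst Bochner_Integration.integral_add) (auto intro: int1 int2 integrable_mult_right)
qed

lemma nonneg_perturbed_hankel:
  assumes "AE x in halfline. \<sigma> x + c * w x \<ge> 0"
  shows "nonneg_operator (perturbed_hankel \<sigma> (\<lambda>t. c * v t))"
  unfolding nonneg_operator_def
proof safe
  fix f g assume fg: "(f, g) \<in> perturbed_hankel \<sigma> (\<lambda>t. c * v t)"
  have "(LINT x|halfline. (cmod (laplace f x))\<^sup>2 * (\<sigma> x + c * w x)) \<ge> 0"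
    using assms by (intro integral_nonneg_AE) (auto elim!: eventually_mono)
  then show "ip g f \<in> \<real>\<^sub>\<ge>\<^sub>0"
    unfolding form_identity(2)[OF fg] by simp
qed

end

section \<open>Test functions\<close>

text \<open>Normalized so that its transform is exactly \<open>1 / (1 + x)^(m+1)\<close>.\<close>
definition power_exp :: "nat \<Rightarrow> real \<Rightarrow> complex"
  where "power_exp m t = of_real (t ^ m * exp (- t) / fact m)"

lemma power_exp_L2: "power_exp m \<in> L2"
  and laplace_power_exp: "x > 0 \<Longrightarrow> laplace (power_exp m) x = of_real (1 / (1 + x) ^ (m + 1))"
proof -
  have pw: "t ^ m = t powr (real (m + 1) - 1)" if "t > 0" for t :: real and m
    using that by (simp add: powr_realpow)
  have [measurable]: "power_exp m \<in> borel_measurable halfline"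
    unfolding power_exp_def by measurable
  have "(\<integral>\<^sup>+t. (emod (power_exp m) t)\<^sup>2 \<partial>halfline) = (\<integral>\<^sup>+t. ennreal (1 / (fact m)\<^sup>2) * ennreal (t powr (real (2 * m + 1) - 1) * exp (- t * 2)) \<partial>halfline)"
  proof (intro nn_integral_cong)
    fix t :: real assume "t \<in> space halfline"
    then have t: "t > 0" by simp
    have "(cmod (power_exp m t))\<^sup>2 = 1 / (fact m)\<^sup>2 * (t ^ (2 * m) * exp (- t * 2))"
      unfolding power_exp_def norm_of_real power2_abs
      by (simp add: power_divide power_mult_distrib power_mult[symmetric] mult.commute exp_double[symmetric])
    then show "(emod (power_exp m) t)\<^sup>2 = ennreal (1 / (fact m)\<^sup>2) * ennreal (t powr (real (2 * m + 1) - 1) * exp (- t * 2))"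
      unfolding pw[OF t, symmetric] using t by (subst ennreal_mult[symmetric]) (auto simp: ennreal_power)
  qed
  also have "\<dots> = ennreal (1 / (fact m)\<^sup>2) * (\<integral>\<^sup>+t. ennreal (t powr (real (2 * m + 1) - 1) * exp (- t * 2)) \<partial>halfline)"
    by (rule nn_integral_cmult) measurable
  also have "\<dots> < \<infinity>"
    by (subst nn_integral_powr_exp) (auto simp: ennreal_mult_less_top)
  finally show "power_exp m \<in> L2"
    by (simp add: L2_iff)
  assume x: "x > 0"
  have "laplace (power_exp m) x = (LINT t|halfline. of_real (1 / fact m * (t ^ m * exp (- t * (1 + x)))))"
    unfolding laplace_def power_exp_def
  proof (intro Bochner_Integration.integral_cong refl)
    fix t :: real
    have "exp (- t * (1 + x)) = exp (- t) * exp (- t * x)"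
      by (simp add: algebra_simps flip: exp_add)
    then have "exp (- t * x) * (t ^ m * exp (- t) / fact m) = 1 / fact m * (t ^ m * exp (- t * (1 + x)))"
      by simp
    then show "exp (- t * x) *\<^sub>R complex_of_real (t ^ m * exp (- t) / fact m) = of_real (1 / fact m * (t ^ m * exp (- t * (1 + x))))"
      by (simp only: scaleR_conv_of_real of_real_mult[symmetric])
  qed
  also have "\<dots> = of_real (1 / fact m * (LINT t|halfline. t ^ m * exp (- t * (1 + x))))"
    by (simp only: integral_complex_of_real integral_mult_right_zero)
  also have "(LINT t|halfline. t ^ m * exp (- t * (1 + x))) = enn2real (\<integral>\<^sup>+t. ennreal (t ^ m * exp (- t * (1 + x))) \<partial>halfline)"
    by (rule integral_eq_nn_integral) (measurable, rule AE_I2, simp)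
  also have "(\<integral>\<^sup>+t. ennreal (t ^ m * exp (- t * (1 + x))) \<partial>halfline) = (\<integral>\<^sup>+t. ennreal (t powr (real (m + 1) - 1) * exp (- t * (1 + x))) \<partial>halfline)"
    by (intro nn_integral_cong) (simp only: pw space_halfline greaterThan_iff)
  also have "\<dots> = ennreal (Gamma (real (m + 1)) * (1 + x) powr - real (m + 1))"
    by (rule nn_integral_powr_exp) (use x in auto)
  also have "Gamma (real (m + 1)) = fact m"
    using Gamma_fact[of m, where 'a = real] by (simp add: add.commute)
  also have "1 / fact m * enn2real (ennreal (fact m * (1 + x) powr - real (m + 1))) = 1 / (1 + x) ^ (m + 1)"
    using x powr_realpow[of "1 + x" "m + 1"] unfolding powr_minus_divide by simp
  finally show "laplace (power_exp m) x = of_real (1 / (1 + x) ^ (m + 1))" .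
qed

text \<open>
  The simple zero at the origin compensates singularities of sigma-functions weaker than \<open>1/x\<close>;
  the exponent \<open>K\<close> is adapted to their growth at infinity.
\<close>
definition test_weight :: "nat \<Rightarrow> real \<Rightarrow> real"
  where "test_weight K x = x / (1 + x) ^ (K + 2)"

lemma test_weight_pos: "x > 0 \<Longrightarrow> test_weight K x > 0"
  by (simp add: test_weight_def)

lemma test_function_exists:
  assumes "real_polynomial_function p"
  obtains f where "f \<in> L2" "\<And>x. x > 0 \<Longrightarrow> laplace f x = of_real (test_weight K x * p (1 / (1 + x)))"
proof -
  obtain a n where p: "p = (\<lambda>x. \<Sum>i\<le>n. a i * x ^ i)"
    using assms real_polynomial_function_iff_sum by blast
  \<comment> \<open>The difference of two consecutive powers of \<open>1/(1 + x)\<close> has the factor \<open>x\<close> in its numerator.\<close>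
  define e where "e = (\<lambda>i t. power_exp (K + i) t + (- 1) * power_exp (K + i + 1) t)"
  have e: "e i \<in> L2" for i
    unfolding e_def by (intro L2_add L2_cmult power_exp_L2)
  have Le: "laplace (e i) x = of_real (test_weight K x * (1 / (1 + x)) ^ i)" if x: "x > 0" for i x
  proof -
    have "laplace (e i) x = laplace (\<lambda>t. \<Sum>j\<in>{0, 1}. (if j = 0 then 1 else - 1) * power_exp (K + i + j) t) x"
      unfolding e_def by (rule laplace_cong) simp
    also have "\<dots> = (\<Sum>j\<in>{0, 1}. (if j = 0 then 1 else - 1) * laplace (power_exp (K + i + j)) x)"
      by (rule laplace_sum) (use x power_exp_L2 in auto)
    also have "\<dots> = of_real (1 / (1 + x) ^ (K + i + 1) - 1 / (1 + x) ^ (K + i + 2))"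
      using x by (simp add: laplace_power_exp add.assoc)
    also have "1 / (1 + x) ^ (K + i + 1) - 1 / (1 + x) ^ (K + i + 2) = test_weight K x * (1 / (1 + x)) ^ i"
    proof -
      have "1 / (1 + x) ^ (K + i + 1) = (1 + x) / (1 + x) ^ (K + i + 2)"
        using x by simp
      then have "1 / (1 + x) ^ (K + i + 1) - 1 / (1 + x) ^ (K + i + 2) = x / (1 + x) ^ (K + i + 2)"
        by (simp only: diff_divide_distrib[symmetric] add_diff_cancel_left')
      then show ?thesis
        by (simp add: test_weight_def power_add power_one_over mult_ac)
    qed
    finally show ?thesis .
  qed
  show ?thesis
  proof (rule that[of "\<lambda>t. \<Sum>i\<le>n. of_real (a i) * e i t"])
    show "(\<lambda>t. \<Sum>i\<le>n. of_real (a i) * e i t) \<in> L2"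
      by (rule L2_sum) (auto intro: e)
    fix x :: real assume x: "x > 0"
    have "laplace (\<lambda>t. \<Sum>i\<le>n. of_real (a i) * e i t) x = (\<Sum>i\<le>n. of_real (a i) * laplace (e i) x)"
      by (rule laplace_sum) (auto intro: e x)
    also have "\<dots> = of_real (test_weight K x * p (1 / (1 + x)))"
      by (simp add: Le[OF x] p sum_distrib_left mult_ac)
    finally show "laplace (\<lambda>t. \<Sum>i\<le>n. of_real (a i) * e i t) x = of_real (test_weight K x * p (1 / (1 + x)))" .
  qed
qed

text \<open>
  The indicator is almost everywhere a limit of continuous functions. These are truncated to
  \<open>[0,1]\<close> and transplanted to \<open>y = 1/(1 + x)\<close>, which ranges over a bounded interval, where they are
  approximated uniformly by polynomials.
\<close>
lemma indicator_polynomial_approximation: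
  assumes S: "S \<in> sets lebesgue"
  obtains p :: "nat \<Rightarrow> real \<Rightarrow> real" where
    "\<And>n. real_polynomial_function (p n)"
    "\<And>n y. y \<in> {0..1} \<Longrightarrow> \<bar>p n y\<bar> \<le> 2"
    "AE x in halfline. (\<lambda>n. p n (1 / (1 + x))) \<longlonglongrightarrow> indicator S x"
proof -
  have "(\<lambda>_. 1 :: real) measurable_on S"
    by (rule lebesgue_measurable_imp_measurable_on) (use S in auto)
  then obtain N g where N: "negligible N" and g: "\<And>n. continuous_on UNIV (g n)"
    and lim: "\<And>x. x \<notin> N \<Longrightarrow> (\<lambda>n. g n x) \<longlonglongrightarrow> (if x \<in> S then 1 else (0::real))"
    unfolding measurable_on_def by blast
  \<comment> \<open>Replacing \<open>y\<close> by \<open>max y (1/(n + 1))\<close> freezes the function beyond \<open>x = n\<close> and makes it continuous at \<open>y = 0\<close>.\<close>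
  define G where "G = (\<lambda>n y. max 0 (min 1 (g n (1 / max y (1 / real (n + 1)) - 1))))"
  have G01: "0 \<le> G n y" "G n y \<le> 1" for n y
    by (auto simp: G_def)
  have "\<exists>p. real_polynomial_function p \<and> (\<forall>y\<in>{0..1}. \<bar>G n y - p y\<bar> < 1 / real (n + 1))" for n
  proof -
    have nz: "max y (1 / real (n + 1)) \<noteq> 0" for y
      by (smt (verit) of_nat_0_less_iff zero_less_divide_1_iff add_gr_0 zero_less_one)
    have "continuous_on {0..1} (G n)"
      unfolding G_def
      by (intro continuous_intros continuous_on_compose2[OF g]) (use nz in auto)
    then show ?thesis
      using Stone_Weierstrass_real_polynomial_function[of "{0..1}" "G n" "1 / real (n + 1)"]
      by (metis compact_Icc of_nat_0_less_iff zero_less_divide_1_iff add_gr_0 zero_less_one)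
  qed
  then obtain p where p: "\<And>n. real_polynomial_function (p n)"
    and close: "\<And>n y. y \<in> {0..1} \<Longrightarrow> \<bar>G n y - p n y\<bar> < 1 / real (n + 1)"
    by metis
  have bound: "\<bar>p n y\<bar> \<le> 2" if "y \<in> {0..1}" for n y
  proof -
    have "1 / real (n + 1) \<le> 1" by simp
    then show ?thesis
      using close[OF that, of n] G01[of n y] by linarith
  qed
  have "(\<lambda>n. p n (1 / (1 + x))) \<longlonglongrightarrow> indicator S x" if x: "x > 0" "x \<notin> N" for x
  proof -
    have y: "1 / (1 + x) \<in> {0..1}" using x by simp
    have "(\<lambda>n. max 0 (min 1 (g n x))) \<longlonglongrightarrow> max 0 (min 1 (if x \<in> S then 1 else 0))"
      by (intro tendsto_intros lim x)
    then have "(\<lambda>n. max 0 (min 1 (g n x))) \<longlonglongrightarrow> indicator S x"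
      by (cases "x \<in> S") simp_all
    moreover have "eventually (\<lambda>n. max 0 (min 1 (g n x)) = G n (1 / (1 + x))) sequentially"
      using eventually_ge_at_top[of "nat \<lceil>x\<rceil>"]
    proof eventually_elim
      case (elim n)
      then have "x \<le> real n" by linarith
      then have "max (1 / (1 + x)) (1 / real (n + 1)) = 1 / (1 + x)"
        using x by (intro max_absorb1 divide_left_mono) auto
      then show ?case
        using x by (simp add: G_def)
    qed
    ultimately have "(\<lambda>n. G n (1 / (1 + x))) \<longlonglongrightarrow> indicator S x"
      by (rule Lim_transform_eventually)
    moreover have "(\<lambda>n. G n (1 / (1 + x)) - p n (1 / (1 + x))) \<longlonglongrightarrow> 0"
    proof (rule Lim_null_comparison)
      show "eventually (\<lambda>n. norm (G n (1 / (1 + x)) - p n (1 / (1 + x))) \<le> 1 / real (n + 1)) sequentially"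
        using close[OF y] by (auto intro!: always_eventually less_imp_le)
      show "(\<lambda>n. 1 / real (n + 1)) \<longlonglongrightarrow> 0"
        using LIMSEQ_inverse_real_of_nat by (simp add: inverse_eq_divide)
    qed
    ultimately have "(\<lambda>n. G n (1 / (1 + x)) - (G n (1 / (1 + x)) - p n (1 / (1 + x)))) \<longlonglongrightarrow> indicator S x - 0"
      by (rule tendsto_diff)
    then show ?thesis by simp
  qed
  moreover have "AE x in halfline. x \<notin> N"
    using N by (intro AE_halfline_lebesgue AE_not_in) (simp add: negligible_iff_null_sets)
  ultimately have "AE x in halfline. (\<lambda>n. p n (1 / (1 + x))) \<longlonglongrightarrow> indicator S x"
    using AE_halfline_pos by (auto elim!: eventually_elim2)
  with p bound that show ?thesis by blast
qed

section \<open>Uniqueness for the Laplace transform\<close>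

lemma fsigma_ball: "fsigma (ball (z :: complex) a)"
proof -
  have "ball z a = (\<Union>n. cball z (a - inverse (real (Suc n))))"
  proof (intro equalityI subsetI)
    fix w assume "w \<in> ball z a"
    then obtain n where "inverse (real (Suc n)) < a - dist z w"
      using reals_Archimedean[of "a - dist z w"] by auto
    then show "w \<in> (\<Union>n. cball z (a - inverse (real (Suc n))))"
      by (auto intro!: exI[of _ n])
  next
    fix w assume "w \<in> (\<Union>n. cball z (a - inverse (real (Suc n))))"
    then obtain n where "dist z w \<le> a - inverse (real (Suc n))"
      by auto
    moreover have "inverse (real (Suc n)) > 0" by simp
    ultimately show "w \<in> ball z a"
      unfolding mem_ball by linarith
  qed
  then show ?thesis
    by (simp add: fsigma.intros)
qed

text \<open>
  By symmetry, \<open>\<integral> Lu f = \<integral> u Lf = 0\<close> for all square integrable \<open>u\<close>. The transforms \<open>Lu\<close> of the test functions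
  approximate \<open>b\<close> times any indicator, so that \<open>\<integral>\<^sub>S b f = 0\<close> for all measurable \<open>S\<close>.
\<close>
lemma laplace_injective:
  assumes f: "f \<in> L2" and zero: "\<And>x. x > 0 \<Longrightarrow> laplace f x = 0"
  shows "AE t in halfline. f t = 0"
proof -
  note [measurable] = L2_measurable[OF f]
  define b where "b = test_weight 0"
  have b_pos: "b t > 0" if "t > 0" for t
    using that by (simp add: b_def test_weight_def)
  have [measurable]: "b \<in> borel_measurable halfline"
    unfolding b_def test_weight_def by measurable
  have int: "integrable halfline (\<lambda>t. of_real (b t) * f t)"
    and poly: "real_polynomial_function p \<Longrightarrow> (LINT t|halfline. of_real (b t * p (1 / (1 + t))) * f t) = 0" for p
  proof -
    have *: "integrable halfline (\<lambda>t. of_real (b t * p (1 / (1 + t))) * f t) \<and> (LINT t|halfline. of_real (b t * p (1 / (1 + t))) * f t) = 0"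
      if p: "real_polynomial_function p" for p
    proof -
      obtain u where u: "u \<in> L2" and Lu: "\<And>x. x > 0 \<Longrightarrow> laplace u x = of_real (b x * p (1 / (1 + x)))"
        using test_function_exists[OF p, of 0] unfolding b_def by blast
      note [measurable] = L2_measurable[OF u]
      have "(\<integral>\<^sup>+x. emod u x * nn_laplace (emod f) x \<partial>halfline) < \<infinity>"
        by (intro nn_pairing_finite nn_laplace_L2_finite L2_emod_finite u f) measurable
      then have "(LINT t|halfline. laplace u t * f t) = (LINT x|halfline. u x * laplace f x)"
        by (rule laplace_symmetric(2)[rotated 2]) measurable
      also have "\<dots> = (LINT x|halfline. 0)"
        by (intro Bochner_Integration.integral_cong) (simp_all add: zero)
      finally have "(LINT t|halfline. laplace u t * f t) = 0" by simp
      moreover have "integrable halfline (\<lambda>t. laplace u t * f t)"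
        by (intro L2_mult_integrable laplace_L2 u f)
      moreover
      have eq: "laplace u t * f t = of_real (b t * p (1 / (1 + t))) * f t" if "t \<in> space halfline" for t
        using that by (simp add: Lu)
      have "integrable halfline (\<lambda>t. laplace u t * f t) \<longleftrightarrow> integrable halfline (\<lambda>t. of_real (b t * p (1 / (1 + t))) * f t)"
        by (rule Bochner_Integration.integrable_cong[OF refl eq])
      moreover have "(LINT t|halfline. laplace u t * f t) = (LINT t|halfline. of_real (b t * p (1 / (1 + t))) * f t)"
        by (rule Bochner_Integration.integral_cong[OF refl eq])
      ultimately show ?thesis by (simp only: simp_thms)
    qed
    show "integrable halfline (\<lambda>t. of_real (b t) * f t)"
      using *[of "\<lambda>_. 1"] by (simp add: real_polynomial_function.intros)
    show "real_polynomial_function p \<Longrightarrow> (LINT t|halfline. of_real (b t * p (1 / (1 + t))) * f t) = 0" for p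
      using * by blast
  qed
  have set: "(LINT t|halfline. of_real (indicator S t) * (of_real (b t) * f t)) = 0" if S: "S \<in> sets lebesgue" for S
  proof -
    obtain p where p: "\<And>n. real_polynomial_function (p n)"
      and bd: "\<And>n y. y \<in> {0..1} \<Longrightarrow> \<bar>p n y\<bar> \<le> 2"
      and lim: "AE x in halfline. (\<lambda>n. p n (1 / (1 + x))) \<longlonglongrightarrow> indicator S x"
      using indicator_polynomial_approximation[OF S] by blast
    have "S \<inter> {0<..} \<in> sets halfline"
      using S by (auto simp: sets_restrict_space)
    then have [measurable]: "(indicator S :: real \<Rightarrow> real) \<in> borel_measurable halfline"
      by (subst borel_measurable_indicator_iff) (simp add: Int_commute)
    have pm [measurable]: "p n \<in> borel_measurable borel" for n
      using p[of n] by (intro borel_measurable_continuous_onI continuous_at_imp_continuous_on ballI continuous_real_polymonial_function)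
    have "(\<lambda>n. LINT t|halfline. of_real (p n (1 / (1 + t))) * (of_real (b t) * f t)) \<longlonglongrightarrow> (LINT t|halfline. of_real (indicator S t) * (of_real (b t) * f t))"
    proof (rule integral_dominated_convergence[where w = "\<lambda>t. 2 * cmod (of_real (b t) * f t)"])
      show "integrable halfline (\<lambda>t. 2 * cmod (of_real (b t) * f t))"
        by (intro integrable_mult_right integrable_norm int)
      show "AE t in halfline. (\<lambda>n. of_real (p n (1 / (1 + t))) * (of_real (b t) * f t)) \<longlonglongrightarrow> of_real (indicator S t) * (of_real (b t) * f t)"
        using lim by eventually_elim (intro tendsto_intros)
      show "AE t in halfline. cmod (of_real (p n (1 / (1 + t))) * (of_real (b t) * f t)) \<le> 2 * cmod (of_real (b t) * f t)" for n
      proof (rule AE_I2)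
        fix t :: real assume "t \<in> space halfline"
        then have "1 / (1 + t) \<in> {0..1}" by simp
        from bd[OF this, of n] show "cmod (of_real (p n (1 / (1 + t))) * (of_real (b t) * f t)) \<le> 2 * cmod (of_real (b t) * f t)"
          unfolding norm_mult[of "of_real (p n _)"] norm_of_real by (intro mult_right_mono) auto
      qed
    qed measurable
    moreover have "(LINT t|halfline. of_real (p n (1 / (1 + t))) * (of_real (b t) * f t)) = 0" for n
      using poly[OF p[of n]] by (simp add: mult_ac)
    ultimately show ?thesis
      by (simp add: LIMSEQ_const_iff)
  qed
  \<comment> \<open>Rotating \<open>f\<close> by the four units reduces the claim to an upper bound for one real function.\<close>
  have part: "AE t in halfline. q t \<le> 0"
    if q: "q = (\<lambda>t. Re (c * f t))" and c: "c \<in> {1, -1, \<i>, -\<i>}" for q c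
  proof -
    let ?S = "{t \<in> space halfline. q t > 0}"
    have [measurable]: "q \<in> borel_measurable halfline"
      unfolding q by measurable
    have "?S \<in> sets halfline" by measurable
    then have S: "?S \<in> sets lebesgue"
      by (rule sets_halfline_lebesgue)
    have [measurable]: "(\<lambda>t. complex_of_real (indicator ?S t)) \<in> borel_measurable halfline"
      by measurable
    have i: "integrable halfline (\<lambda>t. c * (of_real (indicator ?S t) * (of_real (b t) * f t)))"
    proof (intro integrable_mult_right)
      show "integrable halfline (\<lambda>t. of_real (indicator ?S t) * (of_real (b t) * f t))"
        by (rule Bochner_Integration.integrable_bound[OF int]) (measurable, simp add: indicator_def)
    qed
    have "(LINT t|halfline. c * (of_real (indicator ?S t) * (of_real (b t) * f t))) = 0"
      by (simp only: integral_mult_right_zero set[OF S] mult_zero_right)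
    then have "(LINT t|halfline. Re (c * (of_real (indicator ?S t) * (of_real (b t) * f t)))) = 0"
      by (simp only: integral_Re[OF i] zero_complex.sel)
    moreover have "Re (c * (of_real (indicator ?S t) * (of_real (b t) * f t))) = indicator ?S t * b t * q t" for t
    proof -
      have "c * (of_real (indicator ?S t) * (of_real (b t) * f t)) = of_real (indicator ?S t * b t) * (c * f t)"
        by (simp add: mult_ac)
      then show ?thesis
        by (simp only: times_complex.sel Re_complex_of_real Im_complex_of_real mult_zero_left diff_zero q)
    qed
    ultimately have z: "(LINT t|halfline. indicator ?S t * b t * q t) = 0"
      and ii: "integrable halfline (\<lambda>t. indicator ?S t * b t * q t)"
      using integrable_Re[OF i] by simp_all
    have "AE t in halfline. 0 \<le> indicator ?S t * b t * q t"
    proof (rule AE_I2)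
      fix t assume "t \<in> space halfline"
      then show "0 \<le> indicator ?S t * b t * q t"
        using b_pos[of t] by (cases "q t > 0") simp_all
    qed
    from integral_nonneg_eq_0_iff_AE[OF ii this] z
    have "AE t in halfline. indicator ?S t * b t * q t = 0"
      by (simp only: simp_thms)
    then show ?thesis
      using AE_halfline_pos
    proof eventually_elim
      case (elim t)
      then show ?case
        using b_pos[of t] by (cases "q t > 0") simp_all
    qed
  qed
  have "AE t in halfline. Re (1 * f t) \<le> 0" "AE t in halfline. Re (-1 * f t) \<le> 0"
    "AE t in halfline. Re (\<i> * f t) \<le> 0" "AE t in halfline. Re (-\<i> * f t) \<le> 0"
    by (rule part[OF refl]; simp)+
  then show ?thesis
    by eventually_elim (simp add: complex_eq_iff)
qed

text \<open>
  Expanding \<open>exp(z t)\<close> shows that \<open>z \<mapsto> Lf(a - z)\<close> is given by a power series in the disc of radius \<open>a\<close>,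
  and a nonconstant holomorphic function has only countably many zeros. With \<open>a\<close> arbitrarily large
  these discs cover every point of the half-line.
\<close>
lemma laplace_zero_of_uncountable_zeros:
  assumes f: "f \<in> L2" and Z: "uncountable {x. x > 0 \<and> laplace f x = 0}" and y: "y > 0"
  shows "laplace f y = 0"
proof -
  let ?Z = "{x. x > 0 \<and> laplace f x = 0}"
  note [measurable] = L2_measurable[OF f]
  have "?Z = (\<Union>n. ?Z \<inter> {..<real n})"
    using reals_Archimedean2 by auto
  then have "\<exists>n. uncountable (?Z \<inter> {..<real n})"
    using Z countable_UN[of "UNIV :: nat set" "\<lambda>n. ?Z \<inter> {..<real n}"] by auto
  then obtain n where n: "uncountable (?Z \<inter> {..<real n})" ..
  define a where "a = max (real n) y"
  have a: "a > 0" "y \<le> a" "real n \<le> a"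
    using y by (auto simp: a_def)
  define F where "F = (\<lambda>z. LINT t|halfline. exp (z * of_real t) * (exp (- t * a) *\<^sub>R f t))"
  define c where "c = (\<lambda>k. LINT t|halfline. of_real (t ^ k / fact k) * (exp (- t * a) *\<^sub>R f t))"
  have F_real: "F (of_real (a - x)) = laplace f x" for x
  proof -
    have "exp (complex_of_real (a - x) * of_real t) * (exp (- t * a) *\<^sub>R f t) = exp (- t * x) *\<^sub>R f t" for t
    proof -
      have "exp (complex_of_real (a - x) * of_real t) = of_real (exp ((a - x) * t))"
        by (simp only: of_real_mult[symmetric] exp_of_real)
      moreover have "exp ((a - x) * t) * exp (- t * a) = exp (- t * x)"
        by (simp add: algebra_simps flip: exp_add)
      ultimately show ?thesis
        by (simp only: scaleR_conv_of_real mult.assoc[symmetric] of_real_mult[symmetric])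
    qed
    then show ?thesis
      by (simp only: F_def laplace_def)
  qed
  \<comment> \<open>All partial sums of the exponential series are dominated by \<open>exp(t |z|)\<close>.\<close>
  have part_bound: "cmod ((\<Sum>k<N. of_real (t ^ k / fact k) * z ^ k) * (exp (- t * a) *\<^sub>R f t)) \<le> cmod (exp (- t * (a - cmod z)) *\<^sub>R f t)"
    if t: "t > 0" for N t z
  proof -
    have "cmod (\<Sum>k<N. of_real (t ^ k / fact k) * z ^ k) \<le> (\<Sum>k<N. (t * cmod z) ^ k / fact k)"
      by (rule order.trans[OF norm_sum sum_mono])
         (use t in \<open>simp add: norm_mult norm_power norm_divide power_mult_distrib\<close>)
    also have "\<dots> \<le> exp (t * cmod z)"
      using sum_le_suminf[OF summable_exp[of "t * cmod z"], of "{..<N}"] t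
      by (simp add: exp_def divide_inverse mult.commute)
    finally have "cmod (\<Sum>k<N. of_real (t ^ k / fact k) * z ^ k) * (exp (- t * a) * cmod (f t)) \<le> exp (t * cmod z) * (exp (- t * a) * cmod (f t))"
      by (rule mult_right_mono) simp
    also have "\<dots> = exp (- t * (a - cmod z)) * cmod (f t)"
      by (simp add: algebra_simps flip: exp_add)
    finally show ?thesis
      unfolding norm_mult norm_scaleR abs_exp_cancel .
  qed
  have sums: "(\<lambda>k. c k * (z - 0) ^ k) sums F z" if "z \<in> ball 0 a" for z
  proof -
    have za: "a - cmod z > 0" using that by simp
    let ?h = "\<lambda>t. exp (- t * a) *\<^sub>R f t"
    note dom = integrable_laplace[OF f za]
    \<comment> \<open>A single term is the difference of two dominated partial sums, taken at the point \<open>a/2\<close>.\<close>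
    have summand: "integrable halfline (\<lambda>t. of_real (t ^ k / fact k) * ?h t)" for k
    proof -
      have k: "integrable halfline (\<lambda>t. (\<Sum>k<N. of_real (t ^ k / fact k) * (of_real (a / 2)) ^ k) * ?h t)" for N
      proof (rule Bochner_Integration.integrable_bound)
        show "integrable halfline (\<lambda>t. exp (- t * (a - cmod (of_real (a / 2)))) *\<^sub>R f t)"
          by (rule integrable_laplace[OF f]) (use a in simp)
        show "AE t in halfline. cmod ((\<Sum>k<N. of_real (t ^ k / fact k) * (of_real (a / 2)) ^ k) * ?h t) \<le> cmod (exp (- t * (a - cmod (of_real (a / 2)))) *\<^sub>R f t)"
          by (rule AE_I2, rule part_bound) simp
      qed measurable
      have "integrable halfline (\<lambda>t. ((\<Sum>k<Suc k. of_real (t ^ k / fact k) * (of_real (a / 2)) ^ k) * ?h t - (\<Sum>k<k. of_real (t ^ k / fact k) * (of_real (a / 2)) ^ k) * ?h t) * inverse (of_real (a / 2) ^ k))"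
        by (intro Bochner_Integration.integrable_diff integrable_mult_left k)
      also have "(\<lambda>t. ((\<Sum>k<Suc k. of_real (t ^ k / fact k) * (of_real (a / 2)) ^ k) * ?h t - (\<Sum>k<k. of_real (t ^ k / fact k) * (of_real (a / 2)) ^ k) * ?h t) * inverse (of_real (a / 2) ^ k)) = (\<lambda>t. of_real (t ^ k / fact k) * ?h t)"
      proof -
        have alg: "((A + B * q) * h - A * h) * inverse q = B * h" if "q \<noteq> 0" for A B q h :: complex
          using that by (simp add: field_simps)
        have q: "complex_of_real (a / 2) ^ k \<noteq> 0"
          using a by simp
        show ?thesis
          by (simp only: sum.lessThan_Suc alg[OF q])
      qed
      finally show ?thesis .
    qed
    have "(\<lambda>N. LINT t|halfline. (\<Sum>k<N. of_real (t ^ k / fact k) * z ^ k) * ?h t) \<longlonglongrightarrow> F z"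
      unfolding F_def
    proof (rule integral_dominated_convergence[where w = "\<lambda>t. cmod (exp (- t * (a - cmod z)) *\<^sub>R f t)"])
      show "AE t in halfline. (\<lambda>N. (\<Sum>k<N. of_real (t ^ k / fact k) * z ^ k) * ?h t) \<longlonglongrightarrow> exp (z * of_real t) * ?h t"
      proof (rule AE_I2, intro tendsto_intros)
        fix t :: real
        have "(\<lambda>k. (z * of_real t) ^ k /\<^sub>R fact k) sums exp (z * of_real t)"
          by (rule exp_converges)
        also have "(\<lambda>k. (z * of_real t) ^ k /\<^sub>R fact k) = (\<lambda>k. of_real (t ^ k / fact k) * z ^ k)"
          by (simp add: fun_eq_iff scaleR_conv_of_real power_mult_distrib divide_inverse mult_ac)
        finally show "(\<lambda>N. \<Sum>k<N. of_real (t ^ k / fact k) * z ^ k) \<longlonglongrightarrow> exp (z * of_real t)"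
          by (simp only: sums_def)
      qed
      show "AE t in halfline. cmod ((\<Sum>k<N. of_real (t ^ k / fact k) * z ^ k) * ?h t) \<le> cmod (exp (- t * (a - cmod z)) *\<^sub>R f t)" for N
        by (rule AE_I2, rule part_bound) simp
      show "integrable halfline (\<lambda>t. cmod (exp (- t * (a - cmod z)) *\<^sub>R f t))"
        by (rule integrable_norm[OF dom])
    qed measurable
    moreover have "(LINT t|halfline. (\<Sum>k<N. of_real (t ^ k / fact k) * z ^ k) * ?h t) = (\<Sum>k<N. c k * z ^ k)" for N
    proof -
      have "(LINT t|halfline. (\<Sum>k<N. of_real (t ^ k / fact k) * z ^ k) * ?h t) = (LINT t|halfline. (\<Sum>k<N. z ^ k * (of_real (t ^ k / fact k) * ?h t)))"
      proof -
        have "(\<Sum>k<N. A k * z ^ k) * h = (\<Sum>k<N. z ^ k * (A k * h))" for A :: "nat \<Rightarrow> complex" and h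
          unfolding sum_distrib_right by (rule sum.cong) simp_all
        then show ?thesis by (simp only:)
      qed
      also have "\<dots> = (\<Sum>k<N. (LINT t|halfline. z ^ k * (of_real (t ^ k / fact k) * ?h t)))"
        by (intro Bochner_Integration.integral_sum integrable_mult_right summand)
      also have "\<dots> = (\<Sum>k<N. c k * z ^ k)"
      proof (intro sum.cong refl)
        fix k
        show "(LINT t|halfline. z ^ k * (of_real (t ^ k / fact k) * ?h t)) = c k * z ^ k"
          unfolding c_def mult.commute[of _ "z ^ k"] by (rule integral_mult_right_zero)
      qed
      finally show ?thesis .
    qed
    ultimately show ?thesis
      by (simp add: sums_def)
  qed
  have hol: "F holomorphic_on ball 0 a"
    by (rule power_series_holomorphic[OF sums])
  have const: "F constant_on ball 0 a"
  proof (rule ccontr)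
    assume "\<not> F constant_on ball 0 a"
    then have "countable {z \<in> ball 0 a. F z = 0}"
      by (intro holomorphic_countable_zeros hol fsigma_ball) auto
    then have "countable ((\<lambda>x. complex_of_real (a - x)) ` (?Z \<inter> {..<real n}))"
    proof (rule countable_subset[rotated])
      show "(\<lambda>x. complex_of_real (a - x)) ` (?Z \<inter> {..<real n}) \<subseteq> {z \<in> ball 0 a. F z = 0}"
        using a by (auto simp: F_real simp del: of_real_diff)
    qed
    then have "countable (?Z \<inter> {..<real n})"
      by (rule countable_image_inj_on) (auto simp: inj_on_def)
    then show False using n by simp
  qed
  have "?Z \<inter> {..<real n} \<noteq> {}"
    using n by (metis countable_empty)
  then obtain x where x: "x > 0" "x < real n" "laplace f x = 0"
    by auto
  have "F (of_real (a - x)) = F (of_real (a - y))"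
    using const x a y by (auto simp: constant_on_def simp del: of_real_diff)
  then show ?thesis
    using x by (simp only: F_real)
qed

section \<open>Negative subspaces and the spectral measure\<close>

text \<open>
  More vectors than coordinates are linearly dependent; the vectors \<open>c j\<close> have coordinates
  indexed by \<open>B\<close>. The induction step is one step of Gaussian elimination.
\<close>
lemma dependent_vectors:
  fixes c :: "'j \<Rightarrow> 'b \<Rightarrow> 'a::field"
  assumes "finite B" "finite J" "card B < card J"
  shows "\<exists>d. (\<exists>j\<in>J. d j \<noteq> 0) \<and> (\<forall>b\<in>B. (\<Sum>j\<in>J. d j * c j b) = 0)"
  using assms
proof (induction B arbitrary: J c rule: finite_induct)
  case empty
  then have "J \<noteq> {}" by auto
  then show ?case by (intro exI[of _ "\<lambda>_. 1"]) auto
next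
  case (insert b B)
  show ?case
  proof (cases "\<forall>j\<in>J. c j b = 0")
    case True
    have "card B < card J" using insert by simp
    with insert.IH[of J c] insert.prems True show ?thesis by auto
  next
    case False
    then obtain i where i: "i \<in> J" "c i b \<noteq> 0" by auto
    let ?J = "J - {i}"
    have "card B < card ?J"
      using insert i by (simp add: card_Diff_singleton)
    with insert.IH[of ?J "\<lambda>j x. c j x - c j b / c i b * c i x"] insert.prems
    obtain d where d: "\<exists>j\<in>?J. d j \<noteq> 0"
      and 0: "\<And>x. x \<in> B \<Longrightarrow> (\<Sum>j\<in>?J. d j * (c j x - c j b / c i b * c i x)) = 0"
      by auto
    define s where "s = (\<Sum>j\<in>?J. d j * c j b) / c i b"
    define e where "e = d(i := - s)"
    have split: "(\<Sum>j\<in>J. e j * c j x) = - s * c i x + (\<Sum>j\<in>?J. d j * c j x)" for x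
      using i insert.prems by (simp add: sum.remove[of J i] e_def)
    have "(\<Sum>j\<in>J. e j * c j x) = 0" if "x \<in> insert b B" for x
    proof (cases "x = b")
      case True
      then show ?thesis using i by (simp add: split s_def)
    next
      case False
      then have "(\<Sum>j\<in>?J. d j * c j x) - s * c i x = 0"
        using 0[of x] that
        by (simp add: right_diff_distrib sum_subtractf s_def sum_divide_distrib sum_distrib_right mult.assoc)
      then show ?thesis by (simp add: split)
    qed
    moreover have "\<exists>j\<in>J. e j \<noteq> 0"
      using d by (auto simp: e_def)
    ultimately show ?thesis by blast
  qed
qed

text \<open>
  Perturbing each matrix entry by at most \<open>\<epsilon>\<close> changes the form at \<open>d\<close> by at most \<open>\<epsilon> N |d|\<^sup>2\<close>, so that a
  negative diagonal form stays negative definite.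
\<close>
lemma gram_negative:
  fixes G :: "nat \<Rightarrow> nat \<Rightarrow> real" and d :: "nat \<Rightarrow> complex"
  assumes G: "\<And>j l. j < N \<Longrightarrow> l < N \<Longrightarrow> \<bar>G j l + (if j = l then a j else 0)\<bar> \<le> \<epsilon>"
    and a: "\<And>j. j < N \<Longrightarrow> \<epsilon> * real N < a j" and d: "\<exists>j<N. d j \<noteq> 0"
  shows "(\<Sum>j<N. \<Sum>l<N. Re (d j * cnj (d l)) * G j l) < 0"
proof -
  let ?r = "\<lambda>j l. Re (d j * cnj (d l))"
  obtain i where i: "i < N" "d i \<noteq> 0" using d by blast
  have r: "\<bar>?r j l\<bar> \<le> ((cmod (d j))\<^sup>2 + (cmod (d l))\<^sup>2) / 2" for j l
  proof -
    have "\<bar>?r j l\<bar> \<le> cmod (d j) * cmod (d l)"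
      using abs_Re_le_cmod[of "d j * cnj (d l)"] by (simp add: norm_mult)
    also have "\<dots> \<le> ((cmod (d j))\<^sup>2 + (cmod (d l))\<^sup>2) / 2"
      using sum_squares_bound[of "cmod (d j)" "cmod (d l)"] by simp
    finally show ?thesis .
  qed
  have "(\<Sum>j<N. \<Sum>l<N. ?r j l * G j l) = (\<Sum>j<N. \<Sum>l<N. ?r j l * (G j l + (if j = l then a j else 0))) - (\<Sum>j<N. a j * (cmod (d j))\<^sup>2)"
  proof -
    have "(\<Sum>l<N. ?r j l * (G j l + (if j = l then a j else 0))) = (\<Sum>l<N. ?r j l * G j l) + a j * (cmod (d j))\<^sup>2" if "j < N" for j
    proof -
      have "?r j j = (cmod (d j))\<^sup>2"
        by (simp add: complex_norm_square[symmetric] del: times_complex.sel)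
      moreover have "(\<Sum>l<N. ?r j l * (if j = l then a j else 0)) = ?r j j * a j"
        using that by (simp add: if_distrib[of "\<lambda>x. _ * x"] cong: if_cong)
      ultimately show ?thesis
        by (simp only: distrib_left sum.distrib mult.commute)
    qed
    then show ?thesis
      by (simp add: sum.distrib)
  qed
  also have "(\<Sum>j<N. \<Sum>l<N. ?r j l * (G j l + (if j = l then a j else 0))) \<le> (\<Sum>j<N. \<Sum>l<N. ((cmod (d j))\<^sup>2 + (cmod (d l))\<^sup>2) / 2 * \<epsilon>)"
  proof (intro sum_mono)
    fix j l assume "j \<in> {..<N}" "l \<in> {..<N}"
    then have "\<bar>?r j l * (G j l + (if j = l then a j else 0))\<bar> \<le> ((cmod (d j))\<^sup>2 + (cmod (d l))\<^sup>2) / 2 * \<epsilon>"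
      unfolding abs_mult by (intro mult_mono r G) auto
    then show "?r j l * (G j l + (if j = l then a j else 0)) \<le> ((cmod (d j))\<^sup>2 + (cmod (d l))\<^sup>2) / 2 * \<epsilon>"
      by linarith
  qed
  also have "(\<Sum>j<N. \<Sum>l<N. ((cmod (d j))\<^sup>2 + (cmod (d l))\<^sup>2) / 2 * \<epsilon>) = (\<Sum>j<N. (\<epsilon> * real N) * (cmod (d j))\<^sup>2)"
    by (simp add: sum.distrib add_divide_distrib distrib_right sum_distrib_left sum_distrib_right[symmetric] sum_divide_distrib[symmetric] flip: sum_distrib_left)
  also have "(\<Sum>j<N. (\<epsilon> * real N) * (cmod (d j))\<^sup>2) - (\<Sum>j<N. a j * (cmod (d j))\<^sup>2) = (\<Sum>j<N. (\<epsilon> * real N - a j) * (cmod (d j))\<^sup>2)"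
    by (simp add: sum_subtractf left_diff_distrib)
  also have "\<dots> < (\<Sum>j<N. 0)"
  proof (rule sum_strict_mono_ex1)
    show "\<forall>j\<in>{..<N}. (\<epsilon> * real N - a j) * (cmod (d j))\<^sup>2 \<le> 0"
      using a by (auto simp: less_imp_le intro!: mult_nonpos_nonneg)
    show "\<exists>j\<in>{..<N}. (\<epsilon> * real N - a j) * (cmod (d j))\<^sup>2 < 0"
    proof
      show "(\<epsilon> * real N - a i) * (cmod (d i))\<^sup>2 < 0"
        using a[OF i(1)] i(2) by (intro mult_neg_pos) simp_all
    qed (use i in simp)
  qed simp
  finally show ?thesis by simp
qed

text \<open>
  Lebesgue measure has no atoms. If each half-line cut off a null set or left one, the supremum of
  those \<open>t\<close> for which \<open>S \<inter> {..t}\<close> is null would carry \<open>S\<close> up to a null set.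
\<close>
lemma split_positive_set:
  fixes S :: "real set"
  assumes S: "S \<in> sets lebesgue" and pos: "S \<notin> null_sets lebesgue"
  obtains T where "T \<in> sets lebesgue" "T \<subseteq> S" "T \<notin> null_sets lebesgue" "S - T \<notin> null_sets lebesgue"
proof -
  define Z where "Z = {t. S \<inter> {..t} \<in> null_sets lebesgue}"
  have meas: "S \<inter> {..t} \<in> sets lebesgue" "S - (S \<inter> {..t}) \<in> sets lebesgue" for t
    by (intro sets.Diff sets.Int S; simp)+
  have "\<exists>t. S \<inter> {..t} \<notin> null_sets lebesgue \<and> S - (S \<inter> {..t}) \<notin> null_sets lebesgue"
  proof (rule ccontr)
    assume "\<not> ?thesis"
    then have alt: "S - (S \<inter> {..t}) \<in> null_sets lebesgue" if "t \<notin> Z" for t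
      using that by (auto simp: Z_def)
    have "Z \<noteq> {}"
    proof
      assume "Z = {}"
      then have "(\<Union>n. S - (S \<inter> {..- real n})) \<in> null_sets lebesgue"
        by (intro null_sets_UN alt) auto
      moreover have "(\<Union>n. S - (S \<inter> {..- real n})) = S"
      proof -
        have "\<exists>n. \<not> x \<le> - real n" for x
          using reals_Archimedean2[of "- x"] by (auto simp: not_le minus_less_iff)
        then show ?thesis by auto
      qed
      ultimately show False using pos by simp
    qed
    have "\<exists>b. b \<notin> Z"
    proof (rule ccontr)
      assume "\<nexists>b. b \<notin> Z"
      then have "(\<Union>n. S \<inter> {..real n}) \<in> null_sets lebesgue"
        by (intro null_sets_UN) (auto simp: Z_def)
      moreover have "(\<Union>n. S \<inter> {..real n}) = S"
        using real_arch_simple by auto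
      ultimately show False using pos by simp
    qed
    then obtain b where b: "b \<notin> Z" ..
    have down: "t' \<in> Z" if "t \<in> Z" "t' \<le> t" for t t'
      using that null_sets_subset[OF _ meas(1), of "S \<inter> {..t}" t'] by (force simp: Z_def)
    have bdd: "bdd_above Z"
      using b down by (intro bdd_aboveI[of _ b]) (meson linear)
    define s where "s = Sup Z"
    have below: "S \<inter> {..s - 1 / real (Suc n)} \<in> null_sets lebesgue" for n
    proof -
      have "s - 1 / real (Suc n) < s" by simp
      then obtain t where "t \<in> Z" "s - 1 / real (Suc n) < t"
        unfolding s_def using less_cSup_iff[OF \<open>Z \<noteq> {}\<close> bdd] by blast
      then show ?thesis
        using down[of t "s - 1 / real (Suc n)"] by (simp add: Z_def)
    qed
    have above: "S - (S \<inter> {..s + 1 / real (Suc n)}) \<in> null_sets lebesgue" for n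
    proof (rule alt, rule notI)
      assume "s + 1 / real (Suc n) \<in> Z"
      then have "s + 1 / real (Suc n) \<le> s"
        unfolding s_def by (rule cSup_upper[OF _ bdd])
      then show False by simp
    qed
    have "(\<Union>n. S \<inter> {..s - 1 / real (Suc n)}) \<union> (\<Union>n. S - (S \<inter> {..s + 1 / real (Suc n)})) \<union> {s} \<in> null_sets lebesgue"
      by (intro null_sets.Un null_sets_UN below above) (auto simp: null_sets_completion_iff)
    then have "S \<in> null_sets lebesgue"
    proof (rule null_sets_subset[OF _ S])
      show "S \<subseteq> (\<Union>n. S \<inter> {..s - 1 / real (Suc n)}) \<union> (\<Union>n. S - (S \<inter> {..s + 1 / real (Suc n)})) \<union> {s}"
      proof
        fix x assume x: "x \<in> S"
        consider "x < s" | "x = s" | "x > s" by linarith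
        then show "x \<in> (\<Union>n. S \<inter> {..s - 1 / real (Suc n)}) \<union> (\<Union>n. S - (S \<inter> {..s + 1 / real (Suc n)})) \<union> {s}"
        proof cases
          case 1
          then obtain n where "inverse (real (Suc n)) < s - x"
            using reals_Archimedean[of "s - x"] by auto
          then have "x \<le> s - 1 / real (Suc n)" by (simp add: inverse_eq_divide)
          then show ?thesis using x by blast
        next
          case 3
          then obtain n where "inverse (real (Suc n)) < x - s"
            using reals_Archimedean[of "x - s"] by auto
          then have "\<not> x \<le> s + 1 / real (Suc n)" by (simp add: inverse_eq_divide)
          then show ?thesis using x by blast
        qed auto
      qed
    qed
    with pos show False by simp
  qed
  then obtain t where "S \<inter> {..t} \<notin> null_sets lebesgue" "S - (S \<inter> {..t}) \<notin> null_sets lebesgue"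
    by blast
  then show thesis
    by (intro that[of "S \<inter> {..t}"] meas) auto
qed

lemma disjoint_positive_subsets:
  fixes S :: "real set"
  assumes "S \<in> sets lebesgue" "S \<notin> null_sets lebesgue"
  shows "\<exists>E. disjoint_family_on E {..<n::nat} \<and>
    (\<forall>j<n. E j \<in> sets lebesgue \<and> E j \<subseteq> S \<and> E j \<notin> null_sets lebesgue)"
  using assms
proof (induction n arbitrary: S)
  case 0
  then show ?case by (simp add: disjoint_family_on_def)
next
  case (Suc n)
  obtain T where T: "T \<in> sets lebesgue" "T \<subseteq> S" "T \<notin> null_sets lebesgue" "S - T \<notin> null_sets lebesgue"
    using split_positive_set[OF Suc.prems] .
  obtain E where E: "disjoint_family_on E {..<n}"
    "\<And>j. j < n \<Longrightarrow> E j \<in> sets lebesgue \<and> E j \<subseteq> T \<and> E j \<notin> null_sets lebesgue"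
    using Suc.IH[OF T(1,3)] by blast
  have "disjoint_family_on (E(n := S - T)) {..<Suc n}"
    using E unfolding disjoint_family_on_def by (auto simp: less_Suc_eq) blast+
  moreover have "(E(n := S - T)) j \<in> sets lebesgue \<and> (E(n := S - T)) j \<subseteq> S \<and> (E(n := S - T)) j \<notin> null_sets lebesgue" if "j < Suc n" for j
    using that E(2)[of j] T Suc.prems by (auto simp: less_Suc_eq)
  ultimately show ?case by blast
qed

lemma projection_sum:
  assumes P: "orthogonal_projection P" and fin: "finite I" and f: "\<And>i. i \<in> I \<Longrightarrow> f i \<in> L2"
  shows "ae_eq (P (\<lambda>t. \<Sum>i\<in>I. d i * f i t)) (\<lambda>t. \<Sum>i\<in>I. d i * P (f i) t)"
proof -
  have lin: "ae_eq (P (\<lambda>t. c * f t + d * g t)) (\<lambda>t. c * P f t + d * P g t)"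
    if "f \<in> L2" "g \<in> L2" for f g c d
    using P that by (simp add: orthogonal_projection_def)
  show ?thesis
    using fin f
  proof (induction I rule: finite_induct)
    case empty
    have "(\<lambda>t. 0) \<in> L2" by (simp add: L2_def)
    from lin[OF this this, of 0 0] show ?case by simp
  next
    case (insert i I)
    have "ae_eq (P (\<lambda>t. d i * f i t + 1 * (\<Sum>i\<in>I. d i * f i t))) (\<lambda>t. d i * P (f i) t + 1 * P (\<lambda>t. \<Sum>i\<in>I. d i * f i t) t)"
      using insert by (intro lin L2_sum) auto
    moreover have "ae_eq (P (\<lambda>t. \<Sum>i\<in>I. d i * f i t)) (\<lambda>t. \<Sum>i\<in>I. d i * P (f i) t)"
      using insert by auto
    ultimately show ?case
      using insert.hyps unfolding ae_eq_def by (auto elim: eventually_elim2)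
  qed
qed

text \<open>
  The easy half of Glazman's lemma. The quadratic form is required to be negative on
  arbitrarily large finite-dimensional subspaces of the domain of the operator itself, since the
  spectral representation of \<open>(Af,f)\<close> is available only there.
\<close>
lemma infinite_negative_spectrumI:
  assumes "\<And>N::nat. \<exists>f. (\<forall>j<N. f j \<in> L2) \<and>
    (\<forall>d. (\<exists>j<N. d j \<noteq> 0) \<longrightarrow> (\<exists>g r. ((\<lambda>t. \<Sum>j<N. d j * f j t), g) \<in> A \<and>
      ip g (\<lambda>t. \<Sum>j<N. d j * f j t) = of_real r \<and> r < 0))"
  shows "infinite_negative_spectrum A"
  unfolding infinite_negative_spectrum_def
proof (intro allI impI notI)
  fix E assume spec: "spectral_measure_of A E" and "finite_dimensional (E {..<0} ` L2)"
  then obtain B where B: "finite B"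
    "\<And>f. f \<in> L2 \<Longrightarrow> \<exists>c. ae_eq (E {..<0} f) (\<lambda>t. \<Sum>b\<in>B. c b * b t)"
    unfolding finite_dimensional_def by blast
  have P: "orthogonal_projection (E {..<0})"
    using spec by (simp add: spectral_measure_of_def projection_valued_measure_def)
  obtain f where f': "\<forall>j<Suc (card B). f j \<in> L2"
    and neg: "\<forall>d. (\<exists>j<Suc (card B). d j \<noteq> 0) \<longrightarrow> (\<exists>g r. ((\<lambda>t. \<Sum>j<Suc (card B). d j * f j t), g) \<in> A \<and>
      ip g (\<lambda>t. \<Sum>j<Suc (card B). d j * f j t) = of_real r \<and> r < 0)"
    using assms[of "Suc (card B)"] by (elim exE conjE)
  then have f: "f j \<in> L2" if "j < Suc (card B)" for j
    using that by blast
  have "\<exists>c. \<forall>j<Suc (card B). ae_eq (E {..<0} (f j)) (\<lambda>t. \<Sum>b\<in>B. c j b * b t)"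
  proof -
    have "\<exists>c. ae_eq (E {..<0} (f j)) (\<lambda>t. \<Sum>b\<in>B. c b * b t)" if "j < Suc (card B)" for j
      using B(2)[OF f[OF that]] .
    then show ?thesis by metis
  qed
  then obtain c where c: "\<And>j. j < Suc (card B) \<Longrightarrow> ae_eq (E {..<0} (f j)) (\<lambda>t. \<Sum>b\<in>B. c j b * b t)"
    by blast
  obtain d where d: "\<exists>j\<in>{..<Suc (card B)}. d j \<noteq> 0"
    and dc: "\<And>b. b \<in> B \<Longrightarrow> (\<Sum>j<Suc (card B). d j * c j b) = 0"
    using dependent_vectors[OF B(1), of "{..<Suc (card B)}" c] by auto
  define F where "F = (\<lambda>t. \<Sum>j<Suc (card B). d j * f j t)"
  have "\<exists>j<Suc (card B). d j \<noteq> 0"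
    using d by (auto simp del: lessThan_Suc)
  with neg obtain g r where g: "(F, g) \<in> A" and r: "ip g F = of_real r" "r < 0"
    unfolding F_def by blast
  \<comment> \<open>The coefficients \<open>d\<close> annihilate the coordinates of all \<open>E((-\<infinity>,0)) f\<^sub>j\<close> with respect to \<open>B\<close>.\<close>
  have "AE t in halfline. E {..<0} F t = 0"
  proof -
    have "AE t in halfline. \<forall>j\<in>{..<Suc (card B)}. E {..<0} (f j) t = (\<Sum>b\<in>B. c j b * b t)"
      using c by (intro AE_finite_allI) (auto simp: ae_eq_def)
    moreover have "AE t in halfline. E {..<0} F t = (\<Sum>j<Suc (card B). d j * E {..<0} (f j) t)"
      using projection_sum[OF P, of "{..<Suc (card B)}" f d] f by (simp add: ae_eq_def F_def)
    ultimately show ?thesis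
    proof eventually_elim
      case (elim t)
      have "E {..<0} F t = (\<Sum>j<Suc (card B). \<Sum>b\<in>B. d j * c j b * b t)"
        unfolding elim(2) using elim(1) by (intro sum.cong refl) (simp add: sum_distrib_left mult.assoc)
      also have "\<dots> = (\<Sum>b\<in>B. (\<Sum>j<Suc (card B). d j * c j b) * b t)"
        by (subst sum.swap) (simp only: sum_distrib_right)
      also have "\<dots> = 0"
        using dc by simp
      finally show ?case .
    qed
  qed
  then have "AE t in halfline. E {..<0} F t * cnj (F t) = 0"
    by eventually_elim simp
  then have "ip (E {..<0} F) F = 0"
    unfolding ip_def by (rule integral_eq_zero_AE)
  then have "Re (ip (E {..<0} F) F) = 0" by simp
  then have "emeasure (spectral_distribution E F) {..<0} = 0"
    by (simp add: spectral_distribution_def emeasure_measure_of_conv)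
  moreover have "{..<0} \<in> sets (spectral_distribution E F)"
    by (simp add: spectral_distribution_def)
  ultimately have "{..<0} \<in> null_sets (spectral_distribution E F)"
    by (rule null_setsI)
  then have "AE x in spectral_distribution E F. x \<ge> 0"
    by (rule AE_I') auto
  then have "(LINT x|spectral_distribution E F. x) \<ge> 0"
    by (rule integral_nonneg_AE)
  moreover have "ip g F = of_real (LINT x|spectral_distribution E F. x)"
    using spec g by (auto simp: spectral_measure_of_def)
  ultimately show False
    using r by simp
qed

section \<open>The sign of the total sigma-function\<close>

context carleman_kernel
begin

text \<open>
  A vector of the kernel has vanishing Laplace transform on \<open>{\<sigma> > 0}\<close>; a set of positive measure
  is uncountable, so that analyticity applies.
\<close>
theorem positive_perturbed_hankel:
  assumes \<sigma> [measurable]: "\<sigma> \<in> borel_measurable halfline" and nn: "\<And>x. x > 0 \<Longrightarrow> \<sigma> x \<ge> 0"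
    and nz: "\<not> (AE x in halfline. \<sigma> x = 0)" and c: "c \<ge> 0"
  shows "positive_operator (perturbed_hankel \<sigma> (\<lambda>t. c * v t))"
proof -
  have "nonneg_operator (perturbed_hankel \<sigma> (\<lambda>t. c * v t))"
    by (rule nonneg_perturbed_hankel, rule AE_I2) (use nn c weight_nonneg in auto)
  moreover have "ae_eq f (\<lambda>_. 0)" if fg: "(f, g) \<in> perturbed_hankel \<sigma> (\<lambda>t. c * v t)" and g: "ae_eq g (\<lambda>_. 0)" for f g
  proof -
    have f: "f \<in> L2"
      using fg by (auto simp: perturbed_hankel_def form_operator_def h0_dom_def)
    have "AE t in halfline. g t * cnj (f t) = 0"
      using g unfolding ae_eq_def by eventually_elim simp
    then have "ip g f = 0"
      unfolding ip_def by (rule integral_eq_zero_AE)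
    then have z: "(LINT x|halfline. (cmod (laplace f x))\<^sup>2 * (\<sigma> x + c * w x)) = 0"
      unfolding form_identity(2)[OF fg] by simp
    have "AE x in halfline. 0 \<le> (cmod (laplace f x))\<^sup>2 * (\<sigma> x + c * w x)"
      by (rule AE_I2) (use nn c weight_nonneg in auto)
    from integral_nonneg_eq_0_iff_AE[OF form_identity(1)[OF fg] this] z
    have "AE x in halfline. (cmod (laplace f x))\<^sup>2 * (\<sigma> x + c * w x) = 0"
      by simp
    then have "AE x in halfline. \<sigma> x \<noteq> 0 \<longrightarrow> laplace f x = 0"
      using AE_halfline_pos
    proof eventually_elim
      case (elim x)
      then show ?case
        using nn[of x] mult_nonneg_nonneg[OF c weight_nonneg[of x]] by auto
    qed
    moreover have "\<not> (AE x in halfline. \<sigma> x \<noteq> 0 \<longrightarrow> laplace f x = 0) \<or> uncountable {x. x > 0 \<and> laplace f x = 0}"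
    proof (rule disjCI, rule notI)
      assume "\<not> uncountable {x. x > 0 \<and> laplace f x = 0}" and ae: "AE x in halfline. \<sigma> x \<noteq> 0 \<longrightarrow> laplace f x = 0"
      then have "{x. x > 0 \<and> laplace f x = 0} \<in> null_sets lebesgue"
        by (intro null_sets_completionI countable_imp_null_set_lborel) simp
      then have "AE x in halfline. x \<notin> {x. x > 0 \<and> laplace f x = 0}"
        by (intro AE_halfline_lebesgue AE_not_in)
      then have "AE x in halfline. \<sigma> x = 0"
        using ae AE_halfline_pos by eventually_elim auto
      with nz show False by simp
    qed
    ultimately have unc: "uncountable {x. x > 0 \<and> laplace f x = 0}"
      by blast
    show ?thesis
      unfolding ae_eq_def
      by (rule laplace_injective[OF f laplace_zero_of_uncountable_zeros[OF f unc]])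
  qed
  ultimately show ?thesis
    unfolding positive_operator_def by blast
qed

context
  fixes \<sigma> :: "real \<Rightarrow> real" and c D :: real and K :: nat
  assumes \<sigma> [measurable]: "\<sigma> \<in> borel_measurable halfline" and nn: "\<And>x. x > 0 \<Longrightarrow> \<sigma> x \<ge> 0"
    and D: "D \<ge> 0" and growth: "AE x in halfline. x * \<sigma> x \<le> D * (1 + x) ^ K"
begin

text \<open>
  Here \<open>\<sigma> |Lf| \<le> D R / (1 + x)\<^sup>2\<close>, which is dominated by a multiple of \<open>1 / (1 + x)\<close>, the transform
  of the square integrable function \<open>exp(-t)\<close>.
\<close>
lemma bounded_multiple_in_Domain:
  assumes f: "f \<in> L2" and R: "R \<ge> 0"
    and Lf: "\<And>x. x > 0 \<Longrightarrow> cmod (laplace f x) \<le> test_weight K x * R"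
  shows "f \<in> Domain (perturbed_hankel \<sigma> (\<lambda>t. c * v t))"
proof (rule test_function_in_Domain[OF \<sigma> f])
  note [measurable] = L2_measurable[OF f] L2_measurable[OF power_exp_L2]
  have fin: "(\<integral>\<^sup>+x. (emod (laplace (power_exp 0)) x)\<^sup>2 \<partial>halfline) < \<infinity>"
    by (intro L2_emod_finite laplace_L2 power_exp_L2)
  show "(\<lambda>x. of_real (\<sigma> x) * laplace f x) \<in> L2"
  proof (rule L2_dominated[OF _ _ fin])
    show "AE x in halfline. emod (\<lambda>x. of_real (\<sigma> x) * laplace f x) x \<le> ennreal (D * R) * emod (laplace (power_exp 0)) x"
      using growth AE_halfline_pos
    proof eventually_elim
      case (elim x)
      have "cmod (of_real (\<sigma> x) * laplace f x) \<le> \<sigma> x * (test_weight K x * R)"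
        using nn[OF elim(2)] Lf[OF elim(2)] by (simp add: norm_mult mult_left_mono)
      also have "\<dots> = (x * \<sigma> x) * (R / (1 + x) ^ (K + 2))"
        by (simp add: test_weight_def)
      also have "\<dots> \<le> (D * (1 + x) ^ K) * (R / (1 + x) ^ (K + 2))"
        using elim R by (intro mult_right_mono) auto
      also have "\<dots> = D * R / (1 + x)\<^sup>2"
        using elim(2) by (simp add: power_add power2_eq_square)
      also have "\<dots> \<le> D * R / (1 + x)"
        using elim(2) D R by (intro divide_left_mono) (auto simp: power2_eq_square)
      also have "\<dots> = D * R * cmod (laplace (power_exp 0) x)"
        using elim(2) by (simp add: laplace_power_exp norm_divide del: of_real_add)
      finally show ?case
        using D R by (simp add: ennreal_mult[symmetric] ennreal_leI)
    qed
  qed measurable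
qed

text \<open>Integrability of the part containing \<open>w\<close> comes for free, as \<open>b\<close> is the transform of a test function.\<close>
lemma integrable_test_weight:
  "integrable halfline (\<lambda>x. (test_weight K x)\<^sup>2 * (\<sigma> x + c * w x))"
proof -
  obtain f where f: "f \<in> L2" and Lf: "\<And>x. x > 0 \<Longrightarrow> laplace f x = of_real (test_weight K x * 1)"
    using test_function_exists[of "\<lambda>_. 1" K] by (auto intro: real_polynomial_function.intros)
  have "f \<in> Domain (perturbed_hankel \<sigma> (\<lambda>t. c * v t))"
    by (rule bounded_multiple_in_Domain[OF f, of 1]) (simp_all add: Lf less_imp_le[OF test_weight_pos])
  then obtain g where "(f, g) \<in> perturbed_hankel \<sigma> (\<lambda>t. c * v t)"
    by blast
  from form_identity(1)[OF this] show ?thesis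
    by (rule Bochner_Integration.integrable_cong[THEN iffD1, OF refl, rotated]) (simp add: Lf)
qed

text \<open>
  On test functions the form is \<open>\<integral> \<tau> |p(1/(1 + x))|\<^sup>2\<close> with \<open>\<tau> = b\<^sup>2 (\<sigma> + c w)\<close> integrable. For polynomials close to
  the indicators of disjoint sets \<open>E\<^sub>j\<close> on which \<open>\<tau> < 0\<close>, dominated convergence brings the Gram matrix near
  \<open>diag(\<integral>\<^sub>E\<^sub>j \<tau>)\<close>.
\<close>
theorem infinite_negative_perturbed_hankel:
  assumes neg: "\<not> (AE x in halfline. \<sigma> x + c * w x \<ge> 0)"
  shows "infinite_negative_spectrum (perturbed_hankel \<sigma> (\<lambda>t. c * v t))"
proof (rule infinite_negative_spectrumI)
  fix N :: nat
  define \<tau> where "\<tau> = (\<lambda>x. (test_weight K x)\<^sup>2 * (\<sigma> x + c * w x))"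
  have \<tau>: "integrable halfline \<tau>"
    unfolding \<tau>_def by (rule integrable_test_weight)
  note [measurable] = borel_measurable_integrable[OF \<tau>]
  note bpos = test_weight_pos[of _ K]
  let ?S = "{x \<in> space halfline. \<not> \<sigma> x + c * w x \<ge> 0}"
  have "?S \<in> sets halfline" by measurable
  then have "?S \<in> sets lebesgue" by (rule sets_halfline_lebesgue)
  from disjoint_positive_subsets[OF this not_null_of_not_AE_halfline[OF neg], of N]
  obtain E where disj: "disjoint_family_on E {..<N}"
    and E: "\<And>j. j < N \<Longrightarrow> E j \<in> sets lebesgue" and ES: "\<And>j. j < N \<Longrightarrow> E j \<subseteq> ?S"
    and En: "\<And>j. j < N \<Longrightarrow> E j \<notin> null_sets lebesgue"
    by blast
  have Epos: "x > 0" "\<tau> x < 0" if "j < N" "x \<in> E j" for j x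
  proof -
    have "x \<in> ?S" using ES that by blast
    then show "x > 0" "\<tau> x < 0"
      using bpos[of x] by (auto simp: \<tau>_def mult_pos_neg)
  qed
  have [measurable]: "(indicator (E j) :: real \<Rightarrow> real) \<in> borel_measurable halfline" if "j < N" for j
  proof -
    have "E j \<inter> {0<..} \<in> sets halfline"
      using E[OF that] by (auto simp: sets_restrict_space)
    then show ?thesis
      by (subst borel_measurable_indicator_iff) (simp add: Int_commute)
  qed
  let ?Q = "\<lambda>j p. (\<forall>n. real_polynomial_function (p n)) \<and> (\<forall>n. \<forall>y\<in>{0..1}. \<bar>p n y\<bar> \<le> 2) \<and>
      (AE x in halfline. (\<lambda>n. p n (1 / (1 + x))) \<longlonglongrightarrow> indicator (E j) x)"
  have "\<forall>j. \<exists>p. j < N \<longrightarrow> ?Q j p"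
  proof
    fix j
    show "\<exists>p. j < N \<longrightarrow> ?Q j p"
    proof (cases "j < N")
      case True
      show ?thesis
        by (rule indicator_polynomial_approximation[OF E[OF True]]) blast
    qed simp
  qed
  from choice[OF this] obtain p where Q: "\<forall>j. j < N \<longrightarrow> ?Q j (p j)" ..
  have p: "real_polynomial_function (p j n)" if "j < N" for j n
    using Q that by blast
  have bd: "\<bar>p j n y\<bar> \<le> 2" if "j < N" "y \<in> {0..1}" for j n y
    using Q that by blast
  have lim: "AE x in halfline. (\<lambda>n. p j n (1 / (1 + x))) \<longlonglongrightarrow> indicator (E j) x" if "j < N" for j
    using Q that by blast
  define P where "P = (\<lambda>j n x. p j n (1 / (1 + x)))"
  have P_bd: "\<bar>P j n x\<bar> \<le> 2" if "j < N" "x > 0" for j n x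
    using bd[OF that(1), of "1 / (1 + x)" n] that(2) by (simp add: P_def)
  have P_meas [measurable]: "P j n \<in> borel_measurable halfline" if "j < N" for j n
  proof -
    have [measurable]: "p j n \<in> borel_measurable borel"
      using p[OF that, of n]
      by (intro borel_measurable_continuous_onI continuous_at_imp_continuous_on ballI continuous_real_polymonial_function)
    show ?thesis
      unfolding P_def by measurable
  qed
  define G where "G = (\<lambda>n j l. LINT x|halfline. \<tau> x * (P j n x * P l n x))"
  define a where "a = (\<lambda>j. - (LINT x|halfline. \<tau> x * indicator (E j) x))"
  have dom: "integrable halfline (\<lambda>x. 4 * \<bar>\<tau> x\<bar>)"
    using \<tau> by (intro integrable_mult_right integrable_abs)
  have PP_bd: "\<bar>\<tau> x * (P j n x * P l n x)\<bar> \<le> 4 * \<bar>\<tau> x\<bar>" if "j < N" "l < N" "x > 0" for j l n x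
  proof -
    have "\<bar>P j n x * P l n x\<bar> \<le> 2 * 2"
      unfolding abs_mult using that by (intro mult_mono P_bd) auto
    then have "\<bar>\<tau> x\<bar> * \<bar>P j n x * P l n x\<bar> \<le> \<bar>\<tau> x\<bar> * (2 * 2)"
      by (intro mult_left_mono) auto
    then show ?thesis
      by (simp add: abs_mult)
  qed
  have PP_int: "integrable halfline (\<lambda>x. \<tau> x * (P j n x * P l n x))" if "j < N" "l < N" for j l n
  proof (rule Bochner_Integration.integrable_bound[OF dom])
    show "AE x in halfline. norm (\<tau> x * (P j n x * P l n x)) \<le> norm (4 * \<bar>\<tau> x\<bar>)"
      by (rule AE_I2) (use PP_bd[OF that] in simp)
  qed (use that in measurable)
  have a_pos: "a j > 0" if j: "j < N" for j
  proof -
    have int: "integrable halfline (\<lambda>x. - (\<tau> x * indicator (E j) x))"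
    proof (rule Bochner_Integration.integrable_bound[OF \<tau>])
      show "AE x in halfline. norm (- (\<tau> x * indicator (E j) x)) \<le> norm (\<tau> x)"
        by (rule AE_I2) (simp add: indicator_def)
    qed (use j in measurable)
    have nn0: "AE x in halfline. 0 \<le> - (\<tau> x * indicator (E j) x)"
      by (rule AE_I2) (use Epos(2)[OF j] in \<open>auto simp: indicator_def intro: less_imp_le\<close>)
    have "a j \<noteq> 0"
    proof
      assume "a j = 0"
      then have "(LINT x|halfline. - (\<tau> x * indicator (E j) x)) = 0"
        unfolding a_def by simp
      then have "AE x in halfline. - (\<tau> x * indicator (E j) x) = 0"
        using integral_nonneg_eq_0_iff_AE[OF int nn0] by simp
      then have "AE x in halfline. x \<notin> E j"
        by eventually_elim (use Epos(2)[OF j] in \<open>force simp: indicator_def\<close>)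
      then have "E j \<in> null_sets lebesgue"
        by (intro null_sets_of_AE_halfline E[OF j]) (use Epos(1)[OF j] in auto)
      with En[OF j] show False by simp
    qed
    moreover have "a j \<ge> 0"
      using integral_nonneg_AE[OF nn0] by (simp add: a_def)
    ultimately show ?thesis by simp
  qed
  have G_lim: "(\<lambda>n. G n j l) \<longlonglongrightarrow> (if j = l then - a j else 0)" if jl: "j < N" "l < N" for j l
  proof -
    have "(\<lambda>n. G n j l) \<longlonglongrightarrow> (LINT x|halfline. \<tau> x * (indicator (E j) x * indicator (E l) x))"
      unfolding G_def
    proof (rule integral_dominated_convergence[OF _ _ dom])
      show "AE x in halfline. (\<lambda>n. \<tau> x * (P j n x * P l n x)) \<longlonglongrightarrow> \<tau> x * (indicator (E j) x * indicator (E l) x)"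
        using lim[OF jl(1)] lim[OF jl(2)] unfolding P_def
        by eventually_elim (intro tendsto_intros)
      show "AE x in halfline. norm (\<tau> x * (P j n x * P l n x)) \<le> 4 * \<bar>\<tau> x\<bar>" for n
        by (rule AE_I2) (use PP_bd[OF jl] in simp)
    qed (use jl in measurable)
    also have "(LINT x|halfline. \<tau> x * (indicator (E j) x * indicator (E l) x)) = (if j = l then - a j else 0)"
    proof (cases "j = l")
      case True
      have "indicator (E l) x * indicator (E l) x = (indicator (E l) x :: real)" for x
        by (simp add: indicator_def)
      with True show ?thesis
        by (simp only: a_def minus_minus if_True simp_thms)
    next
      case False
      then have "E j \<inter> E l = {}"
        using disj jl by (auto simp: disjoint_family_on_def)
      then have "indicator (E j) x * indicator (E l) x = (0 :: real)" for x
        by (auto simp: indicator_def)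
      then show ?thesis
        using False by (simp only: mult_zero_right Bochner_Integration.integral_zero if_False)
    qed
    finally show ?thesis .
  qed
  obtain \<epsilon> where \<epsilon>: "\<epsilon> > 0" "\<And>j. j < N \<Longrightarrow> \<epsilon> * real N < a j"
  proof (cases "N = 0")
    case True
    then show ?thesis using that[of 1] by simp
  next
    case False
    define m where "m = Min (a ` {..<N})"
    have "a ` {..<N} \<noteq> {}"
      using False by (auto simp: lessThan_empty_iff)
    then have m: "m > 0" "\<And>j. j < N \<Longrightarrow> m \<le> a j"
      using a_pos Min_gr_iff[of "a ` {..<N}" 0] by (auto simp: m_def)
    show ?thesis
    proof (rule that[of "m / (2 * real N)"])
      show "m / (2 * real N) > 0" using m False by simp
      fix j assume "j < N"
      then show "m / (2 * real N) * real N < a j"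
        using m(1) m(2)[of j] False by simp
    qed
  qed
  have "eventually (\<lambda>n. \<forall>j\<in>{..<N}. \<forall>l\<in>{..<N}. \<bar>G n j l + (if j = l then a j else 0)\<bar> < \<epsilon>) sequentially"
  proof (intro eventually_ball_finite finite_lessThan ballI)
    fix j l assume "j \<in> {..<N}" "l \<in> {..<N}"
    then have "eventually (\<lambda>n. dist (G n j l) (if j = l then - a j else 0) < \<epsilon>) sequentially"
      using tendstoD[OF G_lim \<epsilon>(1)] by simp
    then show "eventually (\<lambda>n. \<bar>G n j l + (if j = l then a j else 0)\<bar> < \<epsilon>) sequentially"
      by eventually_elim (simp add: dist_real_def split: if_splits)
  qed
  from eventually_happens[OF this]
  obtain n where n': "\<forall>j\<in>{..<N}. \<forall>l\<in>{..<N}. \<bar>G n j l + (if j = l then a j else 0)\<bar> < \<epsilon>"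
    by auto
  have n: "\<bar>G n j l + (if j = l then a j else 0)\<bar> < \<epsilon>" if "j < N" "l < N" for j l
    using n' that by blast
  have "\<forall>j. \<exists>f. j < N \<longrightarrow> f \<in> L2 \<and> (\<forall>x>0. laplace f x = of_real (test_weight K x * P j n x))"
  proof
    fix j
    show "\<exists>f. j < N \<longrightarrow> f \<in> L2 \<and> (\<forall>x>0. laplace f x = of_real (test_weight K x * P j n x))"
    proof (cases "j < N")
      case True
      show ?thesis
        unfolding P_def by (rule test_function_exists[OF p[OF True, of n], of K]) blast
    qed simp
  qed
  from choice[OF this] obtain f
    where f': "\<forall>j. j < N \<longrightarrow> f j \<in> L2 \<and> (\<forall>x>0. laplace (f j) x = of_real (test_weight K x * P j n x))" ..
  have f: "f j \<in> L2" if "j < N" for j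
    using f' that by blast
  have Lf: "laplace (f j) x = of_real (test_weight K x * P j n x)" if "j < N" "x > 0" for j x
    using f' that by blast
  show "\<exists>f. (\<forall>j<N. f j \<in> L2) \<and>
    (\<forall>d. (\<exists>j<N. d j \<noteq> 0) \<longrightarrow> (\<exists>g r. ((\<lambda>t. \<Sum>j<N. d j * f j t), g) \<in> perturbed_hankel \<sigma> (\<lambda>t. c * v t) \<and>
      ip g (\<lambda>t. \<Sum>j<N. d j * f j t) = of_real r \<and> r < 0))"
  proof (intro exI[of _ f] conjI allI impI f)
    fix d :: "nat \<Rightarrow> complex" assume d: "\<exists>j<N. d j \<noteq> 0"
    let ?F = "\<lambda>t. \<Sum>j<N. d j * f j t"
    have F: "?F \<in> L2"
      by (rule L2_sum) (use f in auto)
    have LF: "laplace ?F x = of_real (test_weight K x) * (\<Sum>j<N. d j * of_real (P j n x))" if x: "x > 0" for x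
    proof -
      have "laplace ?F x = (\<Sum>j<N. d j * laplace (f j) x)"
        by (rule laplace_sum) (use f x in auto)
      also have "\<dots> = (\<Sum>j<N. of_real (test_weight K x) * (d j * of_real (P j n x)))"
        by (rule sum.cong) (use x in \<open>simp_all add: Lf mult_ac\<close>)
      finally show ?thesis
        by (simp only: sum_distrib_left)
    qed
    have "?F \<in> Domain (perturbed_hankel \<sigma> (\<lambda>t. c * v t))"
    proof (rule bounded_multiple_in_Domain[OF F, of "\<Sum>j<N. cmod (d j) * 2"])
      fix x :: real assume x: "x > 0"
      have "cmod (\<Sum>j<N. d j * of_real (P j n x)) \<le> (\<Sum>j<N. cmod (d j) * 2)"
        by (rule order.trans[OF norm_sum sum_mono])
           (use x P_bd in \<open>simp add: norm_mult mult_left_mono\<close>)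
      then show "cmod (laplace ?F x) \<le> test_weight K x * (\<Sum>j<N. cmod (d j) * 2)"
        using bpos[OF x] by (simp only: LF[OF x] norm_mult norm_of_real) simp
    qed (simp add: sum_nonneg)
    then obtain g where g: "(?F, g) \<in> perturbed_hankel \<sigma> (\<lambda>t. c * v t)"
      by blast
    have "(LINT x|halfline. (cmod (laplace ?F x))\<^sup>2 * (\<sigma> x + c * w x))
        = (LINT x|halfline. (\<Sum>j<N. \<Sum>l<N. Re (d j * cnj (d l)) * (\<tau> x * (P j n x * P l n x))))"
    proof (intro Bochner_Integration.integral_cong refl)
      fix x :: real assume "x \<in> space halfline"
      then have x: "x > 0" by simp
      let ?z = "\<Sum>j<N. d j * of_real (P j n x)"
      have "(cmod ?z)\<^sup>2 = Re (?z * cnj ?z)"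
        by (simp only: complex_norm_square[symmetric] Re_complex_of_real)
      also have "?z * cnj ?z = (\<Sum>j<N. \<Sum>l<N. of_real (P j n x * P l n x) * (d j * cnj (d l)))"
        unfolding cnj_sum sum_product by (intro sum.cong refl) simp
      also have "Re \<dots> = (\<Sum>j<N. \<Sum>l<N. (P j n x * P l n x) * Re (d j * cnj (d l)))"
        by (simp only: Re_sum times_complex.sel(1)[of "of_real _"] Re_complex_of_real Im_complex_of_real mult_zero_left diff_zero)
      finally have z: "(cmod ?z)\<^sup>2 = (\<Sum>j<N. \<Sum>l<N. (P j n x * P l n x) * Re (d j * cnj (d l)))" .
      have "(cmod (laplace ?F x))\<^sup>2 * (\<sigma> x + c * w x) = \<tau> x * (cmod ?z)\<^sup>2"
        by (simp only: LF[OF x] norm_mult norm_of_real power_mult_distrib power2_abs \<tau>_def mult_ac)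
      then show "(cmod (laplace ?F x))\<^sup>2 * (\<sigma> x + c * w x) = (\<Sum>j<N. \<Sum>l<N. Re (d j * cnj (d l)) * (\<tau> x * (P j n x * P l n x)))"
        unfolding z by (simp only: sum_distrib_left mult_ac)
    qed
    also have "\<dots> = (\<Sum>j<N. \<Sum>l<N. (LINT x|halfline. Re (d j * cnj (d l)) * (\<tau> x * (P j n x * P l n x))))"
    proof -
      have int: "integrable halfline (\<lambda>x. Re (d j * cnj (d l)) * (\<tau> x * (P j n x * P l n x)))" if "j < N" "l < N" for j l
        by (intro integrable_mult_right PP_int that)
      have "(LINT x|halfline. (\<Sum>j<N. \<Sum>l<N. Re (d j * cnj (d l)) * (\<tau> x * (P j n x * P l n x))))
          = (\<Sum>j<N. (LINT x|halfline. (\<Sum>l<N. Re (d j * cnj (d l)) * (\<tau> x * (P j n x * P l n x)))))"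
        by (intro Bochner_Integration.integral_sum Bochner_Integration.integrable_sum int) simp_all
      also have "\<dots> = (\<Sum>j<N. \<Sum>l<N. (LINT x|halfline. Re (d j * cnj (d l)) * (\<tau> x * (P j n x * P l n x))))"
        by (intro sum.cong refl Bochner_Integration.integral_sum int) simp_all
      finally show ?thesis .
    qed
    also have "\<dots> = (\<Sum>j<N. \<Sum>l<N. Re (d j * cnj (d l)) * G n j l)"
      unfolding G_def by (simp only: integral_mult_right_zero)
    also have "\<dots> < 0"
      by (rule gram_negative[OF less_imp_le[OF n] \<epsilon>(2) d])
    finally show "\<exists>g r. (?F, g) \<in> perturbed_hankel \<sigma> (\<lambda>t. c * v t) \<and> ip g ?F = of_real r \<and> r < 0"
      using g form_identity(2)[OF g] by blast
  qed
qed

end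

end

section \<open>Sigma-functions of power type\<close>

text \<open>The sigma-function of the kernel \<open>(t + \<rho>)^k exp(-\<beta> t)\<close>.\<close>
definition power_sigma :: "real \<Rightarrow> real \<Rightarrow> real \<Rightarrow> real \<Rightarrow> real"
  where "power_sigma k \<beta> \<rho> x =
    (if x > \<beta> then (x - \<beta>) powr (- k - 1) * exp (- \<rho> * (x - \<beta>)) / Gamma (- k) else 0)"

lemma power_sigma_measurable: "power_sigma k \<beta> \<rho> \<in> borel_measurable borel"
  unfolding power_sigma_def by measurable

text \<open>Translation by \<open>\<beta>\<close> reduces the integral to Euler's integral for \<open>\<Gamma>(-k)\<close>.\<close>
lemma nn_laplace_power_sigma:
  assumes k: "k < 0" and \<beta>: "\<beta> \<ge> 0" and \<rho>: "\<rho> \<ge> 0" and t: "t > 0"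
  shows "nn_laplace (\<lambda>x. ennreal (power_sigma k \<beta> \<rho> x)) t = ennreal ((t + \<rho>) powr k * exp (- \<beta> * t))"
proof -
  have \<Gamma>: "Gamma (- k) > 0" using k by (simp add: Gamma_real_pos)
  note [measurable] = power_sigma_measurable[of k \<beta> \<rho>]
  have "nn_laplace (\<lambda>x. ennreal (power_sigma k \<beta> \<rho> x)) t
      = (\<integral>\<^sup>+x. ennreal (exp (- x * t)) * ennreal (power_sigma k \<beta> \<rho> x) * indicator {0<..} x \<partial>lborel)"
    unfolding nn_laplace_def by (rule nn_integral_halfline) measurable
  also have "\<dots> = (\<integral>\<^sup>+x. ennreal (exp (- (\<beta> + 1 * x) * t)) * ennreal (power_sigma k \<beta> \<rho> (\<beta> + 1 * x)) * indicator {0<..} (\<beta> + 1 * x) \<partial>lborel)"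
    by (subst nn_integral_real_affine[where c = 1 and t = \<beta>]) simp_all
  also have "\<dots> = (\<integral>\<^sup>+x. ennreal (exp (- \<beta> * t) / Gamma (- k)) * ennreal (x powr (- k - 1) * exp (- x * (t + \<rho>))) * indicator {0<..} x \<partial>lborel)"
  proof (intro nn_integral_cong)
    fix x :: real
    show "ennreal (exp (- (\<beta> + 1 * x) * t)) * ennreal (power_sigma k \<beta> \<rho> (\<beta> + 1 * x)) * indicator {0<..} (\<beta> + 1 * x)
        = ennreal (exp (- \<beta> * t) / Gamma (- k)) * ennreal (x powr (- k - 1) * exp (- x * (t + \<rho>))) * indicator {0<..} x"
    proof (cases "x > 0")
      case True
      have "exp (- (\<beta> + 1 * x) * t) * exp (- \<rho> * x) = exp (- \<beta> * t) * exp (- x * (t + \<rho>))"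
        by (simp add: algebra_simps flip: exp_add)
      then have "exp (- (\<beta> + 1 * x) * t) * (x powr (- k - 1) * exp (- \<rho> * x) / Gamma (- k))
          = exp (- \<beta> * t) / Gamma (- k) * (x powr (- k - 1) * exp (- x * (t + \<rho>)))"
        by (metis (no_types, lifting) mult.left_commute times_divide_eq_left times_divide_eq_right)
      moreover have "power_sigma k \<beta> \<rho> (\<beta> + 1 * x) = x powr (- k - 1) * exp (- \<rho> * x) / Gamma (- k)"
        using True by (simp add: power_sigma_def)
      ultimately show ?thesis
        using True \<beta> \<Gamma> by (simp add: ennreal_mult[symmetric])
    qed (simp add: power_sigma_def)
  qed
  also have "\<dots> = (\<integral>\<^sup>+x. ennreal (exp (- \<beta> * t) / Gamma (- k)) * ennreal (x powr (- k - 1) * exp (- x * (t + \<rho>))) \<partial>halfline)"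
    by (rule nn_integral_halfline[symmetric]) measurable
  also have "\<dots> = ennreal (exp (- \<beta> * t) / Gamma (- k)) * (\<integral>\<^sup>+x. ennreal (x powr (- k - 1) * exp (- x * (t + \<rho>))) \<partial>halfline)"
    by (rule nn_integral_cmult) measurable
  also have "(\<integral>\<^sup>+x. ennreal (x powr (- k - 1) * exp (- x * (t + \<rho>))) \<partial>halfline) = ennreal (Gamma (- k) * (t + \<rho>) powr k)"
    using nn_integral_powr_exp[of "- k" "t + \<rho>"] k t \<rho> by simp
  finally show ?thesis
    using \<Gamma> by (simp add: ennreal_mult[symmetric] mult.commute)
qed

text \<open>
  Near \<open>t = 0\<close> the bound by \<open>C/t\<close> comes from \<open>k \<ge> -1\<close> or \<open>\<rho> > 0\<close>; near infinity it comes from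
  \<open>k \<le> -1\<close> or from exponential decay.
\<close>
lemma power_kernel_bound:
  fixes k \<beta> \<rho> :: real
  assumes \<beta>: "\<beta> \<ge> 0" and \<rho>: "\<rho> \<ge> 0"
    and cases: "k > -1 \<and> \<beta> > 0 \<and> k < 0 \<or> k \<le> -1 \<and> (k < -1 \<longrightarrow> \<rho> > 0)"
  obtains C where "\<And>t. t > 0 \<Longrightarrow> (t + \<rho>) powr k * exp (- \<beta> * t) \<le> C / t"
proof -
  have le: "t * (t + \<rho>) powr k \<le> (t + \<rho>) powr (k + 1)" if t: "t > 0" for t
  proof -
    have "t * (t + \<rho>) powr k \<le> (t + \<rho>) * (t + \<rho>) powr k"
      using \<rho> by (intro mult_right_mono) auto
    also have "\<dots> = (t + \<rho>) powr (k + 1)"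
      using t \<rho> by (simp add: powr_add)
    finally show ?thesis .
  qed
  have "\<exists>C. \<forall>t>0. t * ((t + \<rho>) powr k * exp (- \<beta> * t)) \<le> C"
    using cases
  proof (elim disjE conjE)
    assume k: "k > -1" "k < 0" and b: "\<beta> > 0"
    show ?thesis
    proof (intro exI[of _ "1 + \<rho> + 1 / \<beta>"] allI impI)
      fix t :: real assume t: "t > 0"
      have "(t + \<rho>) powr (k + 1) \<le> 1 + (t + \<rho>)"
      proof (cases "t + \<rho> \<le> 1")
        case True
        then have "(t + \<rho>) powr (k + 1) \<le> 1"
          using k t \<rho> by (intro powr_le1) auto
        then show ?thesis using t \<rho> by linarith
      next
        case False
        then have "(t + \<rho>) powr (k + 1) \<le> (t + \<rho>) powr 1"
          using k by (intro powr_mono) auto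
        then show ?thesis using False by simp
      qed
      with le[OF t] have "t * ((t + \<rho>) powr k * exp (- \<beta> * t)) \<le> (1 + (t + \<rho>)) * exp (- \<beta> * t)"
        by (simp add: mult.assoc[symmetric] mult_right_mono)
      also have "\<dots> = (1 + \<rho>) * exp (- \<beta> * t) + t * exp (- \<beta> * t)"
        by (simp add: algebra_simps)
      also have "\<dots> \<le> (1 + \<rho>) * 1 + 1 / \<beta>"
      proof (rule add_mono)
        show "(1 + \<rho>) * exp (- \<beta> * t) \<le> (1 + \<rho>) * 1"
          using b t \<rho> by (intro mult_left_mono) auto
        have "\<beta> * t \<le> exp (\<beta> * t)"
          using exp_ge_add_one_self[of "\<beta> * t"] by linarith
        then show "t * exp (- \<beta> * t) \<le> 1 / \<beta>"
          using b by (simp add: exp_minus field_simps)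
      qed
      finally show "t * ((t + \<rho>) powr k * exp (- \<beta> * t)) \<le> 1 + \<rho> + 1 / \<beta>" by simp
    qed
  next
    assume k: "k \<le> -1" and r: "k < -1 \<longrightarrow> \<rho> > 0"
    show ?thesis
    proof (intro exI[of _ "max 1 (\<rho> powr (k + 1))"] allI impI)
      fix t :: real assume t: "t > 0"
      have "(t + \<rho>) powr (k + 1) \<le> max 1 (\<rho> powr (k + 1))"
      proof (cases "k = -1")
        case False
        then have "(t + \<rho>) powr (k + 1) \<le> \<rho> powr (k + 1)"
          using k r t by (intro powr_mono2') auto
        then show ?thesis by simp
      qed (use t \<rho> in simp)
      with le[OF t] have "t * (t + \<rho>) powr k \<le> max 1 (\<rho> powr (k + 1))" by linarith
      then have "t * (t + \<rho>) powr k * exp (- \<beta> * t) \<le> max 1 (\<rho> powr (k + 1)) * 1"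
        using \<beta> t by (intro mult_mono) auto
      then show "t * ((t + \<rho>) powr k * exp (- \<beta> * t)) \<le> max 1 (\<rho> powr (k + 1))"
        by (simp add: mult.assoc)
    qed
  qed
  then show ?thesis
    using that by (auto simp: field_simps)
qed

lemma carleman_kernel_power:
  assumes "k < 0" "\<beta> \<ge> 0" "\<rho> \<ge> 0"
    and "k > -1 \<and> \<beta> > 0 \<or> k \<le> -1 \<and> (k < -1 \<longrightarrow> \<rho> > 0)"
  obtains C where "carleman_kernel (power_sigma k \<beta> \<rho>) (\<lambda>t. (t + \<rho>) powr k * exp (- \<beta> * t)) C"
proof -
  obtain C where C: "\<And>t. t > 0 \<Longrightarrow> (t + \<rho>) powr k * exp (- \<beta> * t) \<le> C / t"
  proof -
    have "k > -1 \<and> \<beta> > 0 \<and> k < 0 \<or> k \<le> -1 \<and> (k < -1 \<longrightarrow> \<rho> > 0)"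
      using assms by auto
    from power_kernel_bound[OF assms(2,3) this] that show thesis by blast
  qed
  have "power_sigma k \<beta> \<rho> \<in> borel_measurable halfline"
    by (rule measurable_compose[OF id_halfline power_sigma_measurable])
  moreover have "power_sigma k \<beta> \<rho> x \<ge> 0" for x
    using assms(1) by (auto simp: power_sigma_def intro!: divide_nonneg_nonneg less_imp_le[OF Gamma_real_pos])
  ultimately have "carleman_kernel (power_sigma k \<beta> \<rho>) (\<lambda>t. (t + \<rho>) powr k * exp (- \<beta> * t)) C"
    using nn_laplace_power_sigma[OF assms(1-3)] C by unfold_locales auto
  then show thesis by (rule that)
qed

text \<open>
  The half-line splits into a neighbourhood of \<open>0\<close>, where \<open>x \<sigma>(x) = O(x^(1-p))\<close> is bounded, a compact interval and a
  neighbourhood of infinity.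
\<close>
lemma sigma_growth:
  assumes nn: "\<forall>x>0. \<sigma> x \<ge> 0" and loc: "\<sigma> \<in> Linf_loc"
    and zero: "\<sigma> \<in> O[at_right 0](\<lambda>x. x powr (- p))" and p: "p < 1"
    and inf: "\<sigma> \<in> O[at_top](\<lambda>x. x powr m)"
  obtains D K where "D \<ge> 0" "AE x in halfline. x * \<sigma> x \<le> D * (1 + x) ^ K"
proof -
  obtain a where a: "a > 0" "eventually (\<lambda>x. norm (\<sigma> x) \<le> a * norm (x powr (- p))) (at_right 0)"
    using landau_o.bigE[OF zero] by blast
  then obtain \<delta>0 where \<delta>0: "\<delta>0 > 0" "\<And>x. 0 < x \<Longrightarrow> x < \<delta>0 \<Longrightarrow> norm (\<sigma> x) \<le> a * norm (x powr (- p))"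
    unfolding eventually_at_right_field by auto
  define \<delta> where "\<delta> = min \<delta>0 1"
  obtain b where b: "b > 0" "eventually (\<lambda>x. norm (\<sigma> x) \<le> b * norm (x powr m)) at_top"
    using landau_o.bigE[OF inf] by blast
  then obtain X0 where X0: "\<And>x. x \<ge> X0 \<Longrightarrow> norm (\<sigma> x) \<le> b * norm (x powr m)"
    unfolding eventually_at_top_linorder by auto
  define X where "X = max X0 1"
  define K where "K = nat \<lceil>m\<rceil> + 1"
  have "{\<delta>..X} \<subseteq> {0<..}"
    using \<delta>0(1) by (auto simp: \<delta>_def)
  then obtain c where "AE x in lebesgue_on {\<delta>..X}. \<bar>\<sigma> x\<bar> \<le> c"
    using loc compact_Icc[of \<delta> X] unfolding Linf_loc_def by blast
  then have "AE x in lebesgue. x \<in> {\<delta>..X} \<longrightarrow> \<bar>\<sigma> x\<bar> \<le> c"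
    by (subst (asm) AE_lebesgue_on_iff) auto
  then have c: "AE x in halfline. x \<in> {\<delta>..X} \<longrightarrow> \<bar>\<sigma> x\<bar> \<le> c"
    by (rule AE_halfline_lebesgue)
  define D where "D = a + b + X * \<bar>c\<bar>"
  have X1: "X \<ge> 1" by (simp add: X_def)
  have D: "a \<le> D" "b \<le> D" "X * \<bar>c\<bar> \<le> D" "D \<ge> 0"
    using a(1) b(1) X1 by (auto simp: D_def)
  show thesis
  proof (rule that[OF D(4)])
    show "AE x in halfline. x * \<sigma> x \<le> D * (1 + x) ^ K"
      using c AE_halfline_pos
    proof eventually_elim
      case (elim x)
      have one: "1 \<le> (1 + x) ^ K"
        using elim(2) by simp
      have lift: "x * \<sigma> x \<le> D * (1 + x) ^ K" if "x * \<sigma> x \<le> D"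
        using that mult_left_mono[OF one D(4)] by simp
      consider "x < \<delta>" | "x \<in> {\<delta>..X}" | "x > X" by force
      then show ?case
      proof cases
        case 1
        then have x: "x < \<delta>0" "x < 1" by (auto simp: \<delta>_def)
        have "x * \<sigma> x \<le> x * (a * x powr (- p))"
          using \<delta>0(2)[OF elim(2) x(1)] elim(2) by (intro mult_left_mono) auto
        also have "\<dots> = a * x powr (1 - p)"
          using elim(2) by (simp add: powr_diff powr_minus_divide)
        also have "\<dots> \<le> a * 1"
          using a(1) elim(2) x p by (intro mult_left_mono powr_le1) auto
        finally show ?thesis using D(1) by (intro lift) simp
      next
        case 2
        then have "x * \<sigma> x \<le> X * \<bar>c\<bar>"
          using elim nn by (intro mult_mono) auto
        then show ?thesis using D(3) by (intro lift) simp
      next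
        case 3
        then have x: "x \<ge> X0" "x \<ge> 1" by (auto simp: X_def)
        have "x powr m \<le> x powr real (nat \<lceil>m\<rceil>)"
          using x by (intro powr_mono) linarith+
        also have "\<dots> = x ^ nat \<lceil>m\<rceil>"
          using x by (simp add: powr_realpow)
        finally have "b * x powr m \<le> b * x ^ nat \<lceil>m\<rceil>"
          using b(1) by (intro mult_left_mono) auto
        then have "x * \<sigma> x \<le> x * (b * x ^ nat \<lceil>m\<rceil>)"
          using X0[OF x(1)] x by (intro mult_left_mono) auto
        also have "\<dots> = b * x ^ K"
          by (simp add: K_def)
        also have "\<dots> \<le> D * (1 + x) ^ K"
          using D x b(1) by (intro mult_mono power_mono) auto
        finally show ?thesis .
      qed
    qed
  qed
qed

text \<open>
  On \<open>x > \<beta>\<close> the function under the essential infimum is a constant multiple of \<open>\<sigma>/w\<close>, so that a lower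
  bound for it by \<open>-v\<close> means \<open>\<sigma> + v w \<ge> 0\<close>. On \<open>x < \<beta>\<close> the latter holds because \<open>w\<close> vanishes.
\<close>
lemma nu_le_iff:
  assumes meas: "\<sigma> \<in> borel_measurable halfline" and nn: "\<forall>x>0. \<sigma> x \<ge> 0"
    and k: "k < 0" and \<beta>: "\<beta> \<ge> 0"
  shows "- nu \<sigma> k \<beta> \<rho> \<le> ereal v \<longleftrightarrow> (AE x in halfline. \<sigma> x + v * power_sigma k \<beta> \<rho> x \<ge> 0)"
proof -
  have \<Gamma>: "Gamma (- k) > 0" using k by (simp add: Gamma_real_pos)
  define c where "c = Gamma (- k) * exp (- \<beta> * \<rho>)"
  have c: "c > 0" using \<Gamma> by (simp add: c_def)
  define q where "q = (\<lambda>x. (x - \<beta>) powr (k + 1) * exp (\<rho> * x) * \<sigma> x)"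
  let ?S = "{\<beta>..} \<inter> {0<..} :: real set"
  let ?M = "lebesgue_on ?S"
  have S: "?S \<in> sets lebesgue" by simp
  have nu: "nu \<sigma> k \<beta> \<rho> = ereal c * - esssup ?M (\<lambda>x. - ereal (q x))"
    by (simp add: nu_def essinf_def c_def q_def)
  have q_meas: "(\<lambda>x. - ereal (q x)) \<in> borel_measurable ?M"
  proof -
    note [measurable] = meas
    have "(\<lambda>x. - ereal (q x)) \<in> borel_measurable halfline"
      unfolding q_def by measurable
    then show ?thesis
      by (rule measurable_restrict_mono) auto
  qed
  have q: "\<sigma> x + v * power_sigma k \<beta> \<rho> x \<ge> 0 \<longleftrightarrow> - v \<le> c * q x" if x: "x > \<beta>" for x
  proof -
    define w where "w = power_sigma k \<beta> \<rho> x"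
    have w: "w > 0"
      using x \<Gamma> by (simp add: w_def power_sigma_def)
    have "(x - \<beta>) powr (k + 1) * (x - \<beta>) powr (- k - 1) = 1"
      using x by (simp flip: powr_add)
    moreover have "exp (- \<beta> * \<rho>) * exp (\<rho> * x) * exp (- \<rho> * (x - \<beta>)) = 1"
      by (simp add: algebra_simps flip: exp_add)
    moreover have "c * q x * w = ((x - \<beta>) powr (k + 1) * (x - \<beta>) powr (- k - 1))
        * (exp (- \<beta> * \<rho>) * exp (\<rho> * x) * exp (- \<rho> * (x - \<beta>))) * \<sigma> x"
      using x \<Gamma> by (simp add: c_def q_def w_def power_sigma_def)
    ultimately have "\<sigma> x = c * q x * w" by simp
    then have "\<sigma> x + v * w = (c * q x + v) * w" by (simp add: distrib_right)
    then show ?thesis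
      using w by (auto simp: w_def zero_le_mult_iff)
  qed
  have ae: "(AE x in halfline. \<sigma> x + v * power_sigma k \<beta> \<rho> x \<ge> 0) \<longleftrightarrow> (AE x in ?M. - v \<le> c * q x)"
  proof -
    have "AE x in lebesgue. x \<noteq> \<beta>"
      by (rule AE_not_in[of "{\<beta>}", simplified]) (simp add: null_sets_completion_iff)
    then have same: "AE x in lebesgue. (x \<in> {0<..} \<longrightarrow> \<sigma> x + v * power_sigma k \<beta> \<rho> x \<ge> 0) \<longleftrightarrow> (x \<in> ?S \<longrightarrow> - v \<le> c * q x)"
    proof eventually_elim
      case (elim x)
      show ?case
      proof (cases "x > \<beta>")
        case True
        then show ?thesis using q[OF True] by auto
      next
        case False
        then show ?thesis using elim nn by (auto simp: power_sigma_def)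
      qed
    qed
    have half: "{0<..} \<in> sets (lebesgue :: real measure)" by simp
    show ?thesis
      unfolding AE_lebesgue_on_iff[OF S] AE_lebesgue_on_iff[OF half]
    proof
      assume "AE x in lebesgue. x \<in> {0<..} \<longrightarrow> \<sigma> x + v * power_sigma k \<beta> \<rho> x \<ge> 0"
      with same show "AE x in lebesgue. x \<in> ?S \<longrightarrow> - v \<le> c * q x"
        by eventually_elim blast
    next
      assume "AE x in lebesgue. x \<in> ?S \<longrightarrow> - v \<le> c * q x"
      with same show "AE x in lebesgue. x \<in> {0<..} \<longrightarrow> \<sigma> x + v * power_sigma k \<beta> \<rho> x \<ge> 0"
        by eventually_elim blast
    qed
  qed
  show ?thesis
    unfolding ae
  proof
    assume "- nu \<sigma> k \<beta> \<rho> \<le> ereal v"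
    then have v: "- ereal v \<le> ereal c * - esssup ?M (\<lambda>x. - ereal (q x))"
      unfolding ereal_uminus_le_reorder[of "nu _ _ _ _"] unfolding nu .
    have "AE x in ?M. - ereal (q x) \<le> esssup ?M (\<lambda>x. - ereal (q x))"
      by (rule esssup_AE)
    then show "AE x in ?M. - v \<le> c * q x"
    proof eventually_elim
      case (elim x)
      then have "- esssup ?M (\<lambda>x. - ereal (q x)) \<le> ereal (q x)"
        by (simp add: ereal_uminus_le_reorder)
      then have "ereal c * - esssup ?M (\<lambda>x. - ereal (q x)) \<le> ereal c * ereal (q x)"
        using c by (intro ereal_mult_left_mono) auto
      with v have "- ereal v \<le> ereal c * ereal (q x)" by (rule order.trans)
      then show ?case by simp
    qed
  next
    assume "AE x in ?M. - v \<le> c * q x"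
    then have "AE x in ?M. - ereal (q x) \<le> ereal (v / c)"
      by eventually_elim (use c in \<open>simp add: field_simps\<close>)
    from esssup_I[OF q_meas this] have "- ereal (v / c) \<le> - esssup ?M (\<lambda>x. - ereal (q x))"
      by (simp only: ereal_minus_le_minus)
    then have "ereal c * - ereal (v / c) \<le> nu \<sigma> k \<beta> \<rho>"
      unfolding nu using c by (intro ereal_mult_left_mono) auto
    moreover have "ereal c * - ereal (v / c) = - ereal v"
      using c by simp
    ultimately show "- nu \<sigma> k \<beta> \<rho> \<le> ereal v"
      by (simp only: ereal_uminus_le_reorder[of "nu _ _ _ _"])
  qed
qed

text \<open>
  For \<open>k > -1\<close> the exponent \<open>-k - 1\<close> is negative, so that \<open>w\<close> tends to infinity at \<open>\<beta>\<close> from the right. As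
  \<open>\<beta> > 0\<close>, the function \<open>\<sigma>\<close> is essentially bounded there.
\<close>
lemma power_sigma_dominates_near_beta:
  assumes loc: "\<sigma> \<in> Linf_loc" and k: "k > -1" "k < 0" and \<beta>: "\<beta> > 0" and \<rho>: "\<rho> \<ge> 0" and v: "v < 0"
  shows "\<not> (AE x in halfline. \<sigma> x + v * power_sigma k \<beta> \<rho> x \<ge> 0)"
proof
  assume "AE x in halfline. \<sigma> x + v * power_sigma k \<beta> \<rho> x \<ge> 0"
  then have pos: "AE x in lebesgue. x \<in> {0<..} \<longrightarrow> \<sigma> x + v * power_sigma k \<beta> \<rho> x \<ge> 0"
    by (subst (asm) AE_lebesgue_on_iff) auto
  have \<Gamma>: "Gamma (- k) > 0" using k by (simp add: Gamma_real_pos)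
  have "{\<beta>..\<beta> + 1} \<subseteq> {0<..}" using \<beta> by auto
  then obtain c where "AE x in lebesgue_on {\<beta>..\<beta> + 1}. \<bar>\<sigma> x\<bar> \<le> c"
    using loc compact_Icc[of \<beta> "\<beta> + 1"] unfolding Linf_loc_def by blast
  then have c: "AE x in lebesgue. x \<in> {\<beta>..\<beta> + 1} \<longrightarrow> \<bar>\<sigma> x\<bar> \<le> c"
    by (subst (asm) AE_lebesgue_on_iff) auto
  have "filterlim (\<lambda>y. y powr (- k - 1)) at_top (at_right 0)"
    using k by real_asymp
  then have "eventually (\<lambda>y. y powr (- k - 1) > c * Gamma (- k) * exp \<rho> / - v) (at_right 0)"
    by (simp add: filterlim_at_top_dense)
  then obtain \<epsilon>0 where \<epsilon>0: "\<epsilon>0 > 0" "\<And>y. 0 < y \<Longrightarrow> y < \<epsilon>0 \<Longrightarrow> y powr (- k - 1) > c * Gamma (- k) * exp \<rho> / - v"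
    unfolding eventually_at_right_field by auto
  define \<epsilon> where "\<epsilon> = min \<epsilon>0 1"
  have "AE x in lebesgue. x \<notin> {\<beta><..<\<beta> + \<epsilon>}"
    using pos c
  proof eventually_elim
    case (elim x)
    show ?case
    proof
      assume "x \<in> {\<beta><..<\<beta> + \<epsilon>}"
      then have x: "x > \<beta>" "x - \<beta> < \<epsilon>0" "x - \<beta> < 1" by (auto simp: \<epsilon>_def)
      have "c * Gamma (- k) * exp \<rho> / - v < (x - \<beta>) powr (- k - 1)"
        using \<epsilon>0(2)[of "x - \<beta>"] x by simp
      then have "c * Gamma (- k) * exp \<rho> < - v * (x - \<beta>) powr (- k - 1)"
        using v by (simp add: field_simps)
      then have "c * Gamma (- k) < - v * (x - \<beta>) powr (- k - 1) * exp (- \<rho>)"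
        by (simp add: exp_minus field_simps)
      also have "\<dots> \<le> - v * (x - \<beta>) powr (- k - 1) * exp (- \<rho> * (x - \<beta>))"
      proof (rule mult_left_mono)
        have "\<rho> * (x - \<beta>) \<le> \<rho> * 1"
          using x \<rho> by (intro mult_left_mono) auto
        then show "exp (- \<rho>) \<le> exp (- \<rho> * (x - \<beta>))" by simp
      qed (use v in \<open>simp add: mult_nonpos_nonneg\<close>)
      finally have "c < - v * power_sigma k \<beta> \<rho> x"
        using x \<Gamma> by (simp add: power_sigma_def field_simps)
      moreover have "\<sigma> x \<le> c"
        using elim(2) x by simp
      moreover have "\<sigma> x + v * power_sigma k \<beta> \<rho> x \<ge> 0"
        using elim(1) x \<beta> by simp
      ultimately show False by simp
    qed
  qed
  then have "{\<beta><..<\<beta> + \<epsilon>} \<in> null_sets lebesgue"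
    using AE_iff_null_sets[of "{\<beta><..<\<beta> + \<epsilon>}" lebesgue] by simp
  then have "emeasure lborel {\<beta><..<\<beta> + \<epsilon>} = 0"
    by (simp add: null_sets_completion_iff null_setsD1)
  then show False
    using \<epsilon>0(1) by (simp add: \<epsilon>_def)
qed

theorem theorem4p6:
  fixes \<sigma>\<^sub>0 :: "real \<Rightarrow> real" and l\<^sub>p l\<^sub>m v\<^sub>0 \<beta> \<rho> k :: real
  assumes "\<forall>x>0. \<sigma>\<^sub>0 x \<ge> 0"
    and "\<not> (AE x in halfline. \<sigma>\<^sub>0 x = 0)"
    and "\<sigma>\<^sub>0 \<in> Linf_loc"
    and "\<sigma>\<^sub>0 \<in> O[at_right 0](\<lambda>x. x powr (- l\<^sub>p))" and "l\<^sub>p < 1"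
    and "\<sigma>\<^sub>0 \<in> O[at_top](\<lambda>x. x powr l\<^sub>m)"
    and "\<beta> \<ge> 0" and "\<rho> \<ge> 0" and "k < 0"
  shows "(k > -1 \<and> \<beta> > 0 \<longrightarrow>
      (v\<^sub>0 \<ge> 0 \<longrightarrow>
        positive_operator (perturbed_hankel \<sigma>\<^sub>0 (\<lambda>t. v\<^sub>0 * (t + \<rho>) powr k * exp (- \<beta> * t)))) \<and>
      (v\<^sub>0 < 0 \<longrightarrow>
        infinite_negative_spectrum (perturbed_hankel \<sigma>\<^sub>0 (\<lambda>t. v\<^sub>0 * (t + \<rho>) powr k * exp (- \<beta> * t)))))
    \<and> (k \<le> -1 \<and> (k < -1 \<longrightarrow> \<rho> > 0) \<longrightarrow>
      (ereal v\<^sub>0 \<ge> - nu \<sigma>\<^sub>0 k \<beta> \<rho> \<longrightarrow>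
        nonneg_operator (perturbed_hankel \<sigma>\<^sub>0 (\<lambda>t. v\<^sub>0 * (t + \<rho>) powr k * exp (- \<beta> * t)))) \<and>
      (ereal v\<^sub>0 < - nu \<sigma>\<^sub>0 k \<beta> \<rho> \<longrightarrow>
        infinite_negative_spectrum (perturbed_hankel \<sigma>\<^sub>0 (\<lambda>t. v\<^sub>0 * (t + \<rho>) powr k * exp (- \<beta> * t)))))"
proof -
  let ?w = "power_sigma k \<beta> \<rho>" and ?v = "\<lambda>t. (t + \<rho>) powr k * exp (- \<beta> * t)"
  have meas: "\<sigma>\<^sub>0 \<in> borel_measurable halfline"
    using assms(3) by (simp add: Linf_loc_def)
  have nn: "\<And>x. x > 0 \<Longrightarrow> \<sigma>\<^sub>0 x \<ge> 0"
    using assms(1) by blast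
  obtain D K where growth: "D \<ge> 0" "AE x in halfline. x * \<sigma>\<^sub>0 x \<le> D * (1 + x) ^ K"
    using sigma_growth[OF assms(1,3-6)] .
  have first: "(v\<^sub>0 \<ge> 0 \<longrightarrow> positive_operator (perturbed_hankel \<sigma>\<^sub>0 (\<lambda>t. v\<^sub>0 * ?v t))) \<and>
      (v\<^sub>0 < 0 \<longrightarrow> infinite_negative_spectrum (perturbed_hankel \<sigma>\<^sub>0 (\<lambda>t. v\<^sub>0 * ?v t)))"
    if k: "k > -1 \<and> \<beta> > 0"
  proof -
    obtain C where "carleman_kernel ?w ?v C"
      using carleman_kernel_power[OF assms(9,7,8)] k by blast
    then interpret carleman_kernel ?w ?v C .
    show ?thesis
      using positive_perturbed_hankel[OF meas nn assms(2)]
        infinite_negative_perturbed_hankel[OF meas nn growth]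
        power_sigma_dominates_near_beta[OF assms(3) _ assms(9) _ assms(8)] k
      by blast
  qed
  have second: "(ereal v\<^sub>0 \<ge> - nu \<sigma>\<^sub>0 k \<beta> \<rho> \<longrightarrow> nonneg_operator (perturbed_hankel \<sigma>\<^sub>0 (\<lambda>t. v\<^sub>0 * ?v t))) \<and>
      (ereal v\<^sub>0 < - nu \<sigma>\<^sub>0 k \<beta> \<rho> \<longrightarrow> infinite_negative_spectrum (perturbed_hankel \<sigma>\<^sub>0 (\<lambda>t. v\<^sub>0 * ?v t)))"
    if k: "k \<le> -1 \<and> (k < -1 \<longrightarrow> \<rho> > 0)"
  proof -
    obtain C where "carleman_kernel ?w ?v C"
      using carleman_kernel_power[OF assms(9,7,8)] k by blast
    then interpret carleman_kernel ?w ?v C .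
    note iff = nu_le_iff[OF meas assms(1,9,7), of \<rho> v\<^sub>0]
    show ?thesis
    proof (intro conjI impI)
      assume "ereal v\<^sub>0 \<ge> - nu \<sigma>\<^sub>0 k \<beta> \<rho>"
      then show "nonneg_operator (perturbed_hankel \<sigma>\<^sub>0 (\<lambda>t. v\<^sub>0 * ?v t))"
        unfolding iff by (rule nonneg_perturbed_hankel)
    next
      assume "ereal v\<^sub>0 < - nu \<sigma>\<^sub>0 k \<beta> \<rho>"
      then show "infinite_negative_spectrum (perturbed_hankel \<sigma>\<^sub>0 (\<lambda>t. v\<^sub>0 * ?v t))"
        unfolding not_le[symmetric] iff
        by (intro infinite_negative_perturbed_hankel[OF meas _ growth] nn)
    qed
  qed
  show ?thesis
    unfolding mult.assoc using first second by blast
qed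

end
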